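(* Let $n\geq 2$ be an integer, $0<\rho\leq\infty$, $I=(0,\rho)$, $J=(-\infty,\log\rho)$ (with $\log\infty:=\infty$). Let $f:I\to\mathbb{R}$ be a function such that $f[A]\succeq 0$ for every $A\in\mathbb{P}_n(I)$, and let $g(t)=f(e^t)$ for $t\in J$. Then the distributional derivative $D^{2n-2}g$ is a positive Radon measure on $J$, $D^{2n-3}g$ has a representative that is locally of bounded variation, and $D^{2n-4}g$ has a locally absolutely continuous representative. Consequently all derivatives of $f$ up to order $2n-4$ are classical and continuous, i.e. $f\in C^{2n-4}(I)$.
   Context: For an interval $I\subset(0,\infty)$, $\mathbb{P}_n(I)$ denotes the set of real symmetric positive semidefinite $n\times n$ matrices all of whose entries lie in $I$; $f[A]:=[f(a_{ij})]_{i,j=1}^n$ is the entrywise application of $f$; $\succeq 0$ means positive semidefinite. $D^kg$ denotes the $k$th distributional derivative of a locally integrable function $g$ on $J$ (part of the assertion is that $f$ is continuous, so that $g$ is locally integrable). *)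

theory Defs
  imports "HOL-Analysis.Analysis"
begin

definition psd_matrix :: "real^'n^'n \<Rightarrow> bool" where
  "psd_matrix A \<longleftrightarrow> transpose A = A \<and> (\<forall>x. 0 \<le> x \<bullet> (A *v x))"

definition psd_matrices_in :: "real set \<Rightarrow> (real^'n^'n) set" where
  "psd_matrices_in I = {A. psd_matrix A \<and> (\<forall>i j. A $ i $ j \<in> I)}"

text \<open>Only used for positive arguments.\<close>
definition ereal_ln :: "ereal \<Rightarrow> ereal" where
  "ereal_ln x = (if x = \<infinity> then \<infinity> else ereal (ln (real_of_ereal x)))"

definition test_function :: "real set \<Rightarrow> (real \<Rightarrow> real) \<Rightarrow> bool" where
  "test_function J \<phi> \<longleftrightarrow>
     (\<forall>k x. (deriv ^^ k) \<phi> field_differentiable (at x)) \<and>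
     compact (closure {x. \<phi> x \<noteq> 0}) \<and> closure {x. \<phi> x \<noteq> 0} \<subseteq> J"

text \<open>Distributions on \<open>J\<close> are represented by functionals on all functions; only their values
  on test functions matter, and equality of distributions is stated on test functions.\<close>

type_synonym functional = "(real \<Rightarrow> real) \<Rightarrow> real"

definition distr_eq :: "real set \<Rightarrow> functional \<Rightarrow> functional \<Rightarrow> bool" where
  "distr_eq J S T \<longleftrightarrow> (\<forall>\<phi>. test_function J \<phi> \<longrightarrow> S \<phi> = T \<phi>)"

definition distr_of_fun :: "real set \<Rightarrow> (real \<Rightarrow> real) \<Rightarrow> functional" where
  "distr_of_fun J g = (\<lambda>\<phi>. LINT t:J|lebesgue. g t * \<phi> t)"

definition distr_of_measure :: "real measure \<Rightarrow> functional" where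
  "distr_of_measure \<mu> = (\<lambda>\<phi>. LINT t|\<mu>. \<phi> t)"

definition distr_deriv :: "functional \<Rightarrow> functional" where
  "distr_deriv T = (\<lambda>\<phi>. - T (deriv \<phi>))"

definition locally_integrable_on :: "(real \<Rightarrow> real) \<Rightarrow> real set \<Rightarrow> bool" where
  "locally_integrable_on g J \<longleftrightarrow>
     (\<forall>K. compact K \<and> K \<subseteq> J \<longrightarrow> g absolutely_integrable_on K)"

definition distr_represented_by :: "real set \<Rightarrow> functional \<Rightarrow> (real \<Rightarrow> real) \<Rightarrow> bool" where
  "distr_represented_by J T h \<longleftrightarrow>
     locally_integrable_on h J \<and> distr_eq J T (distr_of_fun J h)"

definition radon_measure_on :: "real set \<Rightarrow> real measure \<Rightarrow> bool" where
  "radon_measure_on J \<mu> \<longleftrightarrow>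
     sets \<mu> = sets (restrict_space borel J) \<and>
     (\<forall>K. compact K \<and> K \<subseteq> J \<longrightarrow> emeasure \<mu> K < \<infinity>) \<and>
     (\<forall>B \<in> sets \<mu>. emeasure \<mu> B = (SUP K \<in> {K. compact K \<and> K \<subseteq> B}. emeasure \<mu> K))"

definition bounded_variation_on :: "(real \<Rightarrow> real) \<Rightarrow> real set \<Rightarrow> bool" where
  "bounded_variation_on h S \<longleftrightarrow>
     (\<exists>C. \<forall>(m::nat) x. (\<forall>i\<le>m. x i \<in> S) \<and> (\<forall>i<m. x i \<le> x (Suc i)) \<longrightarrow>
        (\<Sum>i<m. \<bar>h (x (Suc i)) - h (x i)\<bar>) \<le> C)"

definition absolutely_continuous_on :: "(real \<Rightarrow> real) \<Rightarrow> real set \<Rightarrow> bool" where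
  "absolutely_continuous_on h S \<longleftrightarrow>
     (\<forall>\<epsilon>>0. \<exists>\<delta>>0. \<forall>(m::nat) a b.
        (\<forall>i<m. a i \<le> b i \<and> {a i..b i} \<subseteq> S) \<and>
        disjoint_family_on (\<lambda>i. {a i<..<b i}) {..<m} \<and>
        (\<Sum>i<m. b i - a i) < \<delta> \<longrightarrow>
        (\<Sum>i<m. \<bar>h (b i) - h (a i)\<bar>) < \<epsilon>)"

definition locally_bounded_variation_on :: "(real \<Rightarrow> real) \<Rightarrow> real set \<Rightarrow> bool" where
  "locally_bounded_variation_on h J \<longleftrightarrow>
     (\<forall>a b. {a..b} \<subseteq> J \<longrightarrow> bounded_variation_on h {a..b})"

definition locally_absolutely_continuous_on :: "(real \<Rightarrow> real) \<Rightarrow> real set \<Rightarrow> bool" where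
  "locally_absolutely_continuous_on h J \<longleftrightarrow>
     (\<forall>a b. {a..b} \<subseteq> J \<longrightarrow> absolutely_continuous_on h {a..b})"

text \<open>Meant for open \<open>S\<close>, where the derivatives at points of \<open>S\<close> only depend on the
  values of the function on \<open>S\<close>.\<close>
definition Ck_on :: "nat \<Rightarrow> (real \<Rightarrow> real) \<Rightarrow> real set \<Rightarrow> bool" where
  "Ck_on k f S \<longleftrightarrow>
     (\<forall>j<k. \<forall>x\<in>S. (deriv ^^ j) f field_differentiable (at x)) \<and>
     (\<forall>j\<le>k. continuous_on S ((deriv ^^ j) f))"

end

theory Submission
  imports Defs
begin

text \<open>
  Applying \<open>f\<close> to the rank one matrices with entries \<open>exp (s\<^sub>i + s\<^sub>j)\<close>, \<open>s\<^sub>i = t / 2 + i h\<close>, and testing the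
  result on the coefficients of the \<open>(n - 1)\<close>-st difference shows that the equally spaced differences of
  \<open>g\<close> of order \<open>2 n - 2\<close> are nonnegative. With two nodes the same matrices give midpoint convexity, and
  \<open>a 1 1\<^sup>T + (b - a) Id\<close> gives monotonicity, so that \<open>g\<close> is continuous.

  A continuous function with \<open>\<Delta>\<^sup>m\<^sup>+\<^sup>1 \<ge> 0\<close>, \<open>m \<ge> 2\<close>, is continuously differentiable and its derivative
  satisfies \<open>\<Delta>\<^sup>m \<ge> 0\<close>: the quotients \<open>\<Delta>\<^sub>h\<^sup>m g / h\<^sup>m\<close> are monotone along lattices, hence locally bounded, so
  locally \<open>\<plusminus> g + K exp\<close> has nonnegative \<open>m\<close>-th differences. For \<open>m = 2\<close> both functions are convex, and
  a convex function whose sum with another convex function is continuously differentiable has that property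
  itself; larger \<open>m\<close> follow by induction.

  Hence \<open>g\<close> has a convex derivative of order \<open>2 n - 4\<close>; the next distributional derivatives are its right
  derivative and the measure which the latter generates.
\<close>

section \<open>Finite differences\<close>

lemma atLeastAtMost_subset_convex:
  fixes J :: "real set"
  assumes "convex J" "a \<in> J" "b \<in> J"
  shows "{a..b} \<subseteq> J"
  using interval_subset_is_interval[of J a b] assms by (simp add: is_interval_convex_1)

definition fwd_diff :: "real \<Rightarrow> (real \<Rightarrow> real) \<Rightarrow> real \<Rightarrow> real" where
  "fwd_diff h g = (\<lambda>x. g (x + h) - g x)"

text \<open>Membership in \<open>J\<close> is asked of the first and the last node only. The sets to
  which this is applied are convex, so the nodes between lie in them as well.\<close>

definition diff_nonneg :: "nat \<Rightarrow> (real \<Rightarrow> real) \<Rightarrow> real set \<Rightarrow> bool" where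
  "diff_nonneg m g J \<longleftrightarrow>
     (\<forall>x h. 0 < h \<and> x \<in> J \<and> x + of_nat m * h \<in> J \<longrightarrow> 0 \<le> (fwd_diff h ^^ m) g x)"

lemma fwd_diff_funpow_Suc:
  "(fwd_diff h ^^ Suc m) g x = (fwd_diff h ^^ m) g (x + h) - (fwd_diff h ^^ m) g x"
  by (simp add: fwd_diff_def)

text \<open>The coefficients are signed binomials, but what matters is that they depend on
  \<open>m\<close> alone: one vector \<open>c\<close> serves all functions, steps and base points.
  It allows limits to be taken term by term, and it is the vector on which the quadratic form is
  tested later.\<close>

lemma fwd_diff_expansion:
  obtains c :: "nat \<Rightarrow> real"
  where "\<And>g h x. (fwd_diff h ^^ m) g x = (\<Sum>i\<le>m. c i * g (x + of_nat i * h))"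
proof -
  have "\<exists>c::nat \<Rightarrow> real. \<forall>g h x. (fwd_diff h ^^ m) g x = (\<Sum>i\<le>m. c i * g (x + of_nat i * h))"
  proof (induction m)
    case 0
    show ?case by (rule exI[of _ "\<lambda>_. 1"]) simp
  next
    case (Suc m)
    then obtain c :: "nat \<Rightarrow> real" where
      c: "(fwd_diff h ^^ m) g x = (\<Sum>i\<le>m. c i * g (x + of_nat i * h))" for g h x
      by blast
    \<comment> \<open>Pascal's recursion, shifted minus unshifted coefficients, with coefficients
      outside \<open>{..m}\<close> read as 0.\<close>
    define d where "d i = (if i = 0 then 0 else c (i - 1)) - (if i \<le> m then c i else 0)" for i
    have "(fwd_diff h ^^ Suc m) g x = (\<Sum>i\<le>Suc m. d i * g (x + of_nat i * h))" for g h x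
    proof -
      have "(\<Sum>i\<le>Suc m. d i * g (x + of_nat i * h)) =
        (\<Sum>i\<le>Suc m. (if i = 0 then 0 else c (i - 1)) * g (x + of_nat i * h)) -
        (\<Sum>i\<le>Suc m. (if i \<le> m then c i else 0) * g (x + of_nat i * h))"
        by (simp only: d_def left_diff_distrib sum_subtractf)
      also have "(\<Sum>i\<le>Suc m. (if i = 0 then 0 else c (i - 1)) * g (x + of_nat i * h)) =
        (\<Sum>i\<le>m. c i * g (x + h + of_nat i * h))"
        by (simp only: sum.atMost_Suc_shift) (simp add: algebra_simps)
      also have "(\<Sum>i\<le>Suc m. (if i \<le> m then c i else 0) * g (x + of_nat i * h)) =
        (\<Sum>i\<le>m. c i * g (x + of_nat i * h))"
        by simp
      finally show ?thesis by (simp only: fwd_diff_funpow_Suc c)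
    qed
    then show ?case by blast
  qed
  with that show ?thesis by blast
qed

lemma fwd_diff_funpow_add:
  "(fwd_diff h ^^ m) (\<lambda>x. a * f x + b * g x) x = a * (fwd_diff h ^^ m) f x + b * (fwd_diff h ^^ m) g x"
  by (induction m arbitrary: x) (simp_all add: fwd_diff_def algebra_simps)

lemma fwd_diff_funpow_uminus:
  "(fwd_diff h ^^ m) (\<lambda>x. - g x) x = - (fwd_diff h ^^ m) g x"
  by (induction m arbitrary: x) (simp_all add: fwd_diff_def algebra_simps)

lemma fwd_diff_funpow_commute:
  "(fwd_diff h ^^ m) (fwd_diff k g) x = fwd_diff k ((fwd_diff h ^^ m) g) x"
proof (induction m arbitrary: x)
  case (Suc m)
  show ?case
    unfolding fwd_diff_funpow_Suc Suc.IH unfolding fwd_diff_def[of k]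
    by (simp add: algebra_simps)
qed simp

lemma fwd_diff_funpow_exp: "(fwd_diff h ^^ m) exp x = exp x * (exp h - 1) ^ m"
  by (induction m arbitrary: x) (simp_all add: fwd_diff_def exp_add algebra_simps)

lemma fwd_diff_funpow_abs_le:
  assumes "\<And>i. i \<le> m \<Longrightarrow> \<bar>g (x + of_nat i * h)\<bar> \<le> M"
  shows "\<bar>(fwd_diff h ^^ m) g x\<bar> \<le> 2 ^ m * M"
  using assms
proof (induction m arbitrary: x)
  case (Suc m)
  have "\<bar>g (x + h + of_nat i * h)\<bar> \<le> M" if "i \<le> m" for i
    using Suc.prems[of "Suc i"] that by (simp add: algebra_simps)
  from Suc.IH[OF this] have "\<bar>(fwd_diff h ^^ m) g (x + h)\<bar> \<le> 2 ^ m * M" by simp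
  moreover have "\<bar>(fwd_diff h ^^ m) g x\<bar> \<le> 2 ^ m * M"
    using Suc.prems by (intro Suc.IH) simp
  ultimately show ?case by (simp only: fwd_diff_funpow_Suc power_Suc)
qed simp

lemma fwd_diff_of_nat_mult:
  "fwd_diff (of_nat N * k) g x = (\<Sum>j<N. fwd_diff k g (x + of_nat j * k))"
proof (induction N)
  case (Suc N)
  then show ?case by (simp add: fwd_diff_def algebra_simps)
qed (simp add: fwd_diff_def)

text \<open>A difference of step \<open>of_nat N * k\<close> is a sum of \<open>N\<close>
  differences of step \<open>k\<close>. Iterated \<open>m\<close> times this gives
  \<open>N ^ m\<close> fine differences, whose base points are shifted by at most
  \<open>m * (N - 1)\<close> steps. The induction peels off one coarse difference and commutes it
  past the fine ones.\<close>

lemma fwd_diff_coarse_ge: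
  assumes "\<And>j. j \<le> m * (N - 1) \<Longrightarrow> L \<le> (fwd_diff k ^^ m) g (x + of_nat j * k)"
  shows "of_nat N ^ m * L \<le> (fwd_diff (of_nat N * k) ^^ m) g x"
  using assms
proof (induction m arbitrary: g L)
  case (Suc m)
  have "of_nat N * L \<le> (fwd_diff k ^^ m) (fwd_diff (of_nat N * k) g) (x + of_nat j * k)"
    if j: "j \<le> m * (N - 1)" for j
  proof -
    have "L \<le> (fwd_diff k ^^ Suc m) g (x + of_nat (j + i) * k)" if "i < N" for i
      using j that by (intro Suc.prems) auto
    then have "(\<Sum>i<N. L) \<le> (\<Sum>i<N. (fwd_diff k ^^ Suc m) g (x + of_nat (j + i) * k))"
      by (intro sum_mono) auto
    also have "\<dots> = fwd_diff (of_nat N * k) ((fwd_diff k ^^ m) g) (x + of_nat j * k)"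
      by (simp only: fwd_diff_of_nat_mult) (simp add: algebra_simps)
    finally show ?thesis by (simp add: fwd_diff_funpow_commute)
  qed
  from Suc.IH[OF this] show ?case by (simp only: funpow_Suc_right o_apply) (simp add: algebra_simps)
qed simp

lemma fwd_diff_coarse_le:
  assumes "\<And>j. j \<le> m * (N - 1) \<Longrightarrow> (fwd_diff k ^^ m) g (x + of_nat j * k) \<le> U"
  shows "(fwd_diff (of_nat N * k) ^^ m) g x \<le> of_nat N ^ m * U"
  using fwd_diff_coarse_ge[of m N "- U" k "\<lambda>x. - g x" x] assms
  by (simp add: fwd_diff_funpow_uminus)

lemma diff_nonnegD:
  "diff_nonneg m g J \<Longrightarrow> 0 < h \<Longrightarrow> x \<in> J \<Longrightarrow> x + of_nat m * h \<in> J \<Longrightarrow> 0 \<le> (fwd_diff h ^^ m) g x"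
  unfolding diff_nonneg_def by blast

section \<open>Convexity and supporting lines\<close>

lemma diff_nonneg_2_imp_convex_on:
  fixes g :: "real \<Rightarrow> real"
  assumes J: "convex J" and cont: "continuous_on J g" and diff: "diff_nonneg 2 g J"
  shows "convex_on J g"
proof (rule convex_on_linorderI[OF _ J])
  fix u x y :: real
  assume u: "0 < u" "u < 1" and xy: "x \<in> J" "y \<in> J" "x < y"
  have sub: "{x..y} \<subseteq> J"
    using J xy(1,2) by (intro atLeastAtMost_subset_convex)
  define a where "a = (g y - g x) / (y - x)"
  \<comment> \<open>\<open>\<psi>\<close> is \<open>g\<close> minus its chord over
    \<open>{x..y}\<close>. If its maximum were positive, then at the leftmost maximum point
    \<open>s\<close> the value at \<open>s - h\<close> would be strictly smaller and the value at
    \<open>s + h\<close> no larger, which contradicts the midpoint inequality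
    \<open>mid\<close>.\<close>
  define \<psi> where "\<psi> t = g t - (g x + a * (t - x))" for t
  have \<psi>0: "\<psi> x = 0" "\<psi> y = 0" using xy by (simp_all add: \<psi>_def a_def)
  have cont\<psi>: "continuous_on {x..y} \<psi>"
    unfolding \<psi>_def by (intro continuous_intros continuous_on_subset[OF cont sub])
  have mid: "0 \<le> \<psi> (s - h) - 2 * \<psi> s + \<psi> (s + h)"
    if "0 < h" "s - h \<in> J" "s + h \<in> J" for s h
  proof -
    have "0 \<le> (fwd_diff h ^^ 2) g (s - h)"
      using that by (intro diff_nonnegD[OF diff]) (auto simp: add.commute)
    then have "0 \<le> g (s - h) - 2 * g s + g (s + h)"
      by (simp add: fwd_diff_def numeral_2_eq_2 add.commute)
    then show ?thesis by (simp add: \<psi>_def algebra_simps)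
  qed
  obtain s0 where s0: "s0 \<in> {x..y}" "\<And>t. t \<in> {x..y} \<Longrightarrow> \<psi> t \<le> \<psi> s0"
    using continuous_attains_sup[OF compact_Icc _ cont\<psi>] xy by force
  have "\<psi> s0 \<le> 0"
  proof (rule ccontr)
    assume pos: "\<not> \<psi> s0 \<le> 0"
    define S where "S = {t \<in> {x..y}. \<psi> t = \<psi> s0}"
    have "compact S"
      unfolding S_def
      using continuous_closedin_preimage_constant[OF cont\<psi>] closedin_compact[OF compact_Icc] by blast
    then obtain s where s: "s \<in> S" "\<And>t. t \<in> S \<Longrightarrow> s \<le> t"
    proof -
      have "S \<noteq> {}" using s0(1) unfolding S_def by blast
      from compact_attains_inf[OF \<open>compact S\<close> this] show ?thesis using that by blast
    qed
    define h where "h = min (s - x) (y - s)"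
    have "s \<noteq> x" "s \<noteq> y" using s(1) pos \<psi>0 unfolding S_def by auto
    then have h: "0 < h" "s - h \<in> {x..y}" "s + h \<in> {x..y}"
      using s(1) unfolding S_def h_def by auto
    have "\<psi> (s - h) \<noteq> \<psi> s0"
      using s(2)[of "s - h"] h unfolding S_def by auto
    then have "\<psi> (s - h) < \<psi> s0" "\<psi> (s + h) \<le> \<psi> s0"
      using s0(2)[OF h(2)] s0(2)[OF h(3)] by simp_all
    moreover have "\<psi> s = \<psi> s0" using s(1) unfolding S_def by auto
    ultimately show False
      using mid[OF h(1) subsetD[OF sub h(2)] subsetD[OF sub h(3)]] by simp
  qed
  moreover have "(1 - u) *\<^sub>R x + u *\<^sub>R y \<in> {x..y}"
    using u xy convexD_alt[OF convex_real_interval(5), of x x y y u] by simp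
  ultimately have "\<psi> ((1 - u) *\<^sub>R x + u *\<^sub>R y) \<le> 0"
    using s0(2) by force
  moreover have "(1 - u) *\<^sub>R x + u *\<^sub>R y - x = u * (y - x)" by (simp add: algebra_simps)
  ultimately have "g ((1 - u) *\<^sub>R x + u *\<^sub>R y) \<le> g x + a * (u * (y - x))"
    by (simp add: \<psi>_def)
  also have "\<dots> = (1 - u) * g x + u * g y" using xy by (simp add: a_def field_simps)
  finally show "g ((1 - u) *\<^sub>R x + u *\<^sub>R y) \<le> (1 - u) * g x + u * g y" .
qed

text \<open>The slope of a supporting line at \<open>x\<close> can be taken to be the infimum of the
  slopes of the chords from \<open>x\<close> to points on its right, which is the right
  derivative.\<close>

lemma convex_on_open_subgradient:
  fixes g :: "real \<Rightarrow> real"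
  assumes "open B" "convex_on B g"
  obtains d where "\<And>x y. x \<in> B \<Longrightarrow> y \<in> B \<Longrightarrow> g x + d x * (y - x) \<le> g y"
proof
  fix x y assume "x \<in> B" "y \<in> B"
  then show "g x + Inf ((\<lambda>t. (g x - g t) / (x - t)) ` ({x<..} \<inter> B)) * (y - x) \<le> g y"
    using convex_le_Inf_differential[OF assms(2), of x y] assms(1) by (simp add: interior_open)
qed

text \<open>Supporting lines of \<open>g1\<close> and \<open>g2\<close> at \<open>x\<close> add up
  to one of the differentiable \<open>E\<close>, so their slopes add up to \<open>E' x\<close>. The
  distances of \<open>g1\<close> and \<open>g2\<close> from their lines are nonnegative and sum to
  that of \<open>E\<close>, hence each is bounded by it. In the same way the increments of
  \<open>d1\<close> and \<open>d2\<close> have equal sign and sum to that of \<open>E'\<close>, so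
  \<open>d1\<close> inherits continuity.\<close>

lemma convex_summand_C1:
  fixes g1 g2 :: "real \<Rightarrow> real"
  assumes B: "open B" and g1: "convex_on B g1" and g2: "convex_on B g2"
    and sum: "\<And>x. x \<in> B \<Longrightarrow> g1 x + g2 x = E x"
    and E: "\<And>x. x \<in> B \<Longrightarrow> (E has_real_derivative E' x) (at x)"
    and E': "continuous_on B E'"
  obtains d where "\<And>x. x \<in> B \<Longrightarrow> (g1 has_real_derivative d x) (at x)" "continuous_on B d"
proof -
  obtain d1 where d1: "\<And>x y. x \<in> B \<Longrightarrow> y \<in> B \<Longrightarrow> g1 x + d1 x * (y - x) \<le> g1 y"
    using convex_on_open_subgradient[OF B g1] by blast
  obtain d2 where d2: "\<And>x y. x \<in> B \<Longrightarrow> y \<in> B \<Longrightarrow> g2 x + d2 x * (y - x) \<le> g2 y"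
    using convex_on_open_subgradient[OF B g2] by blast
  have d12: "d1 x + d2 x = E' x" if x: "x \<in> B" for x
  proof -
    obtain e where e: "0 < e" "ball x e \<subseteq> B" using B x openE by blast
    have "((\<lambda>y. E y - (d1 x + d2 x) * y) has_real_derivative E' x - (d1 x + d2 x)) (at x)"
      using E[OF x] by (auto intro!: derivative_eq_intros)
    then have "E' x - (d1 x + d2 x) = 0"
    \<comment> \<open>After subtraction of the summed supporting line, \<open>E\<close> has a local
      minimum at \<open>x\<close>.\<close>
    proof (rule DERIV_local_min[OF _ e(1)], intro allI impI)
      fix y assume "\<bar>x - y\<bar> < e"
      then have y: "y \<in> B" using e by (auto simp: dist_real_def)
      show "E x - (d1 x + d2 x) * x \<le> E y - (d1 x + d2 x) * y"
        using d1[OF x y] d2[OF x y] sum[OF x] sum[OF y] by (simp add: algebra_simps)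
    qed
    then show ?thesis by simp
  qed
  have "(g1 has_real_derivative d1 x) (at x)" if x: "x \<in> B" for x
  proof -
    have lim: "((\<lambda>y. (E y - E x) / (y - x) - E' x) \<longlongrightarrow> 0) (at x)"
      using E[OF x] unfolding has_field_derivative_iff by (simp add: LIM_zero)
    have ev: "\<forall>\<^sub>F y in at x. norm ((g1 y - g1 x) / (y - x) - d1 x) \<le> \<bar>(E y - E x) / (y - x) - E' x\<bar>"
      using eventually_at_in_open'[OF B x] eventually_neq_at_within[of x x UNIV]
    proof eventually_elim
      case (elim y)
      have "\<bar>g1 y - g1 x - d1 x * (y - x)\<bar> \<le> \<bar>E y - E x - E' x * (y - x)\<bar>"
        using d1[OF x elim(1)] d2[OF x elim(1)] sum[OF x] sum[OF elim(1)] d12[OF x, symmetric]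
        by (simp add: algebra_simps)
      then have "\<bar>g1 y - g1 x - d1 x * (y - x)\<bar> / \<bar>y - x\<bar> \<le> \<bar>E y - E x - E' x * (y - x)\<bar> / \<bar>y - x\<bar>"
        by (intro divide_right_mono) auto
      then show ?case using elim(2) by (simp add: diff_divide_distrib flip: abs_divide)
    qed
    from Lim_null_comparison[OF ev tendsto_rabs_zero[OF lim]] show ?thesis unfolding has_field_derivative_iff by (simp add: LIM_zero_iff)
  qed
  moreover have le: "\<bar>d1 y - d1 x\<bar> \<le> \<bar>E' y - E' x\<bar>" if x: "x \<in> B" and y: "y \<in> B" for x y
  proof -
    have "0 \<le> (d1 y - d1 x) * (y - x)" "0 \<le> (d2 y - d2 x) * (y - x)"
      using d1[OF x y] d1[OF y x] d2[OF x y] d2[OF y x] by (simp_all add: algebra_simps)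
    then show ?thesis
      using d12[OF x] d12[OF y] by (cases "x = y") (auto simp: zero_le_mult_iff)
  qed
  have "continuous_on B d1"
    using E' le unfolding continuous_on_iff dist_real_def by (meson order_le_less_trans)
  ultimately show ?thesis using that by blast
qed

section \<open>Local bounds for difference quotients\<close>

lemma fwd_diff_lattice_mono:
  assumes J: "convex J" and diff: "diff_nonneg (Suc m) g J" and h: "0 < h"
    and x: "x \<in> J" "x + of_nat (N + m) * h \<in> J"
  shows "(fwd_diff h ^^ m) g x \<le> (fwd_diff h ^^ m) g (x + of_nat N * h)"
  using x
proof (induction N)
  case (Suc N)
  have sub: "{x..x + of_nat (Suc N + m) * h} \<subseteq> J"
    using J Suc.prems by (intro atLeastAtMost_subset_convex)
  have "0 \<le> (fwd_diff h ^^ Suc m) g (x + of_nat N * h)"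
    using h by (intro diff_nonnegD[OF diff] subsetD[OF sub]) (auto simp: algebra_simps)
  then have "(fwd_diff h ^^ m) g (x + of_nat N * h) \<le> (fwd_diff h ^^ m) g (x + of_nat (Suc N) * h)"
    by (simp only: fwd_diff_funpow_Suc) (simp add: algebra_simps)
  moreover have "x + of_nat (N + m) * h \<in> J"
    using h by (intro subsetD[OF sub]) (auto simp: algebra_simps)
  ultimately show ?case using Suc.IH Suc.prems(1) by linarith
qed simp

text \<open>The difference at \<open>x\<close> is compared with coarse differences whose total
  length is of order \<open>r\<close>, and these are bounded by the size of \<open>g\<close>.
  Monotonicity along the lattice makes the difference at \<open>x\<close> a lower bound for the fine
  differences to its right and an upper bound for those to its left, so a coarse difference on
  either side encloses it after division by \<open>real N ^ m\<close>.\<close>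

lemma fwd_diff_locally_bounded:
  assumes J: "convex J" and diff: "diff_nonneg (Suc m) g J" and bdd: "bounded (g ` {t - 3 * r..t + 3 * r})"
    and m: "0 < m" and r: "0 < r" and sub: "{t - 3 * r..t + 3 * r} \<subseteq> J"
  obtains C where "0 < C"
    "\<And>x h. 0 < h \<Longrightarrow> t - r \<le> x \<Longrightarrow> x + of_nat m * h \<le> t + r \<Longrightarrow> \<bar>(fwd_diff h ^^ m) g x\<bar> \<le> C * h ^ m"
proof -
  obtain M where M: "0 < M" "\<And>y. y \<in> {t - 3 * r..t + 3 * r} \<Longrightarrow> \<bar>g y\<bar> \<le> M"
    using bdd unfolding bounded_pos by auto
  define C where "C = 2 ^ m * M * (of_nat m / r) ^ m"
  show ?thesis
  proof
    show "0 < C" using M m r by (simp add: C_def)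
    fix x h assume h: "0 < h" and x: "t - r \<le> x" "x + of_nat m * h \<le> t + r"
    \<comment> \<open>\<open>N\<close> is the largest number with
      \<open>N * m * h \<le> 2 * r\<close>. As \<open>q\<close> is at least 1, rounding down loses
      at most a factor 2, so a coarse difference spans a length between \<open>r\<close> and
      \<open>2 * r\<close>: short enough to stay within distance \<open>3 * r\<close> of
      \<open>t\<close>, and long enough to give \<open>1 / N \<le> m * h / r\<close>.\<close>
    define q where "q = 2 * r / (of_nat m * h)"
    define N where "N = nat \<lfloor>q\<rfloor>"
    have mh: "0 < of_nat m * h" using m h by simp
    have q1: "1 \<le> q" using x mh unfolding q_def by (subst le_divide_eq) auto
    have N: "1 \<le> real N" "real N \<le> q" "q < real N + 1"
      using q1 unfolding N_def by (auto simp: le_nat_iff)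
    have Nle: "real N * (of_nat m * h) \<le> 2 * r"
      using N(2) mh unfolding q_def by (simp add: le_divide_eq)
    have "2 * r < (real N + 1) * (of_nat m * h)"
      using N(3) mh unfolding q_def by (simp add: divide_less_eq)
    also have "\<dots> \<le> (2 * real N) * (of_nat m * h)"
      using N(1) mh by (intro mult_right_mono) auto
    finally have Ngt: "r < real N * (of_nat m * h)" by simp
    have bd: "\<bar>(fwd_diff (real N * h) ^^ m) g z\<bar> \<le> 2 ^ m * M"
      if z: "t - 3 * r \<le> z" "z + real N * (of_nat m * h) \<le> t + 3 * r" for z
    proof (rule fwd_diff_funpow_abs_le)
      fix i assume "i \<le> m"
      then have "of_nat i * (real N * h) \<le> of_nat m * (real N * h)"
        using h by (intro mult_right_mono) auto
      also have "\<dots> = real N * (of_nat m * h)" by simp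
      finally have "of_nat i * (real N * h) \<le> real N * (of_nat m * h)" .
      moreover have "0 \<le> of_nat i * (real N * h)" using h by simp
      ultimately have "t - 3 * r \<le> z + of_nat i * (real N * h)" "z + of_nat i * (real N * h) \<le> t + 3 * r"
        using z by linarith+
      then show "\<bar>g (z + of_nat i * (real N * h))\<bar> \<le> M" by (intro M(2)) simp
    qed
    define L where "L = (fwd_diff h ^^ m) g x"
    have jb: "real j * h \<le> real N * (of_nat m * h) - of_nat m * h" "0 \<le> real j * h" if "j \<le> m * (N - 1)" for j
    proof -
      have "real j \<le> real (m * (N - 1))" using that by linarith
      also have "\<dots> = real m * (real N - 1)" using N(1) by (simp add: of_nat_diff)
      finally have "real j * h \<le> (real m * (real N - 1)) * h"
        using h by (intro mult_right_mono) auto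
      then show "real j * h \<le> real N * (of_nat m * h) - of_nat m * h" "0 \<le> real j * h"
        using h by (simp_all add: algebra_simps)
    qed
    have up: "real N ^ m * L \<le> (fwd_diff (real N * h) ^^ m) g x"
    proof (rule fwd_diff_coarse_ge)
      fix j assume "j \<le> m * (N - 1)"
      note jb = jb[OF this]
      have "x \<in> J" "x + real (j + m) * h \<in> J"
        using jb x r Nle mh unfolding of_nat_add distrib_right
        by (intro subsetD[OF sub]; simp only: atLeastAtMost_iff; linarith)+
      then show "L \<le> (fwd_diff h ^^ m) g (x + real j * h)"
        unfolding L_def by (intro fwd_diff_lattice_mono[OF J diff h])
    qed
    \<comment> \<open>The coarse difference based at \<open>z\<close> has \<open>x\<close> as its
      last node, so the fine base points in it precede \<open>x\<close> on the same lattice.\<close>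
    define z where "z = x - real N * (of_nat m * h)"
    have lo: "(fwd_diff (real N * h) ^^ m) g z \<le> real N ^ m * L"
    proof (rule fwd_diff_coarse_le)
      fix j assume j: "j \<le> m * (N - 1)"
      then have "j \<le> m * N" by (meson diff_le_self le_trans mult_le_mono2)
      then have eq: "z + real j * h + real (m * N - j) * h = x"
        by (simp add: z_def of_nat_diff algebra_simps)
      have "(fwd_diff h ^^ m) g (z + real j * h)
          \<le> (fwd_diff h ^^ m) g (z + real j * h + real (m * N - j) * h)"
      proof (rule fwd_diff_lattice_mono[OF J diff h])
        show "z + real j * h \<in> J"
          using jb[OF j] x r Nle mh unfolding z_def
          by (intro subsetD[OF sub]; simp only: atLeastAtMost_iff; linarith)
        have "z + real j * h + real (m * N - j + m) * h = x + of_nat m * h"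
          using eq by (simp add: algebra_simps)
        then show "z + real j * h + real (m * N - j + m) * h \<in> J"
          using x h r mh by (intro subsetD[OF sub]) auto
      qed
      then show "(fwd_diff h ^^ m) g (z + real j * h) \<le> L" by (simp add: eq L_def)
    qed
    have "\<bar>(fwd_diff (real N * h) ^^ m) g x\<bar> \<le> 2 ^ m * M" "\<bar>(fwd_diff (real N * h) ^^ m) g z\<bar> \<le> 2 ^ m * M"
      using x r Nle mh by (intro bd; simp add: z_def)+
    with up lo have "\<bar>real N ^ m * L\<bar> \<le> 2 ^ m * M" by linarith
    then have le: "real N ^ m * \<bar>L\<bar> \<le> 2 ^ m * M" by (simp add: abs_mult)
    have ge1: "1 \<le> (of_nat m / r * h * real N) ^ m"
      using Ngt r by (intro one_le_power) (simp add: field_simps)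
    have "1 * (real N ^ m * \<bar>L\<bar>) \<le> (of_nat m / r * h * real N) ^ m * (2 ^ m * M)"
      by (rule mult_mono[OF ge1 le]) (use m r h in simp_all)
    also have "\<dots> = real N ^ m * (C * h ^ m)"
      by (simp add: C_def power_mult_distrib power_divide)
    finally show "\<bar>(fwd_diff h ^^ m) g x\<bar> \<le> C * h ^ m"
      using N(1) by (simp add: L_def)
  qed
qed

section \<open>Differentiability from nonnegative higher differences\<close>

lemma exp_diff_power_ge: "0 < h \<Longrightarrow> exp x * h ^ m \<le> (fwd_diff h ^^ m) exp x"
proof -
  assume "0 < h"
  then have "h ^ m \<le> (exp h - 1) ^ m"
    using exp_ge_add_one_self[of h] by (intro power_mono) linarith+
  then show ?thesis by (simp add: fwd_diff_funpow_exp)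
qed

text \<open>A multiple of \<open>exp\<close> absorbs a difference of size \<open>C * h ^ m\<close>
  of either sign, because the differences of \<open>exp\<close> of every order \<open>m\<close> are
  at least \<open>exp x * h ^ m\<close>. Being smooth, the added term can be subtracted again once
  differentiability is known.\<close>

lemma diff_nonneg_exp_perturb:
  assumes C: "0 \<le> C" "0 < b" and b: "\<And>x. x \<in> B \<Longrightarrow> b \<le> exp x"
    and bd: "\<And>x h. 0 < h \<Longrightarrow> x \<in> B \<Longrightarrow> x + of_nat m * h \<in> B \<Longrightarrow> \<bar>(fwd_diff h ^^ m) g x\<bar> \<le> C * h ^ m"
    and s: "\<bar>s\<bar> = 1"
  shows "diff_nonneg m (\<lambda>x. s * g x + C / b * exp x) B"
  unfolding diff_nonneg_def
proof (intro allI impI)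
  fix x h assume h: "0 < h \<and> x \<in> B \<and> x + real m * h \<in> B"
  have "C * h ^ m = C / b * (b * h ^ m)" using C by simp
  also have "\<dots> \<le> C / b * (exp x * h ^ m)"
    using C h b[of x] by (intro mult_left_mono mult_right_mono) auto
  also have "\<dots> \<le> C / b * (fwd_diff h ^^ m) exp x"
    using C h exp_diff_power_ge[of h x m] by (intro mult_left_mono) auto
  finally have "C * h ^ m \<le> C / b * (fwd_diff h ^^ m) exp x" .
  moreover have "- (C * h ^ m) \<le> s * (fwd_diff h ^^ m) g x"
    using bd[of h x] h s by (auto simp: abs_if split: if_splits)
  ultimately show "0 \<le> (fwd_diff h ^^ m) (\<lambda>x. s * g x + C / b * exp x) x"
    by (simp only: fwd_diff_funpow_add)
qed

lemma diff_nonneg_imp_C1: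
  assumes "2 \<le> m" "open J" "convex J" "continuous_on J g" "diff_nonneg (Suc m) g J"
  shows "\<forall>x\<in>J. g field_differentiable (at x)" and "continuous_on J (deriv g)"
proof -
  \<comment> \<open>A local claim for arbitrary \<open>g\<close>, \<open>J\<close> and
    \<open>t\<close>: each induction step passes to a ball around \<open>t\<close> and to a
    perturbed function whose differences are nonnegative in one order less.\<close>
  have local: "\<exists>r d. 0 < r \<and> ball t r \<subseteq> J \<and> continuous_on (ball t r) d \<and>
      (\<forall>x\<in>ball t r. (g has_real_derivative d x) (at x))" if "t \<in> J" for t
    using assms that
  proof (induction m arbitrary: g J t rule: nat_induct_at_least)
    case (Suc m)
    obtain R where R: "0 < R" "cball t R \<subseteq> J"
      using Suc.prems(1,5) unfolding open_contains_cball by blast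
    \<comment> \<open>Bounding the differences within radius \<open>r\<close> uses the values of
      \<open>g\<close> within radius \<open>3 * r\<close>.\<close>
    define r where "r = R / 3"
    have r: "0 < r" "{t - 3 * r..t + 3 * r} \<subseteq> J" "ball t r \<subseteq> J"
      using R by (auto simp: r_def cball_eq_atLeastAtMost ball_eq_greaterThanLessThan)
    obtain C where C: "0 < C"
      "\<And>x h. 0 < h \<Longrightarrow> t - r \<le> x \<Longrightarrow> x + of_nat (Suc m) * h \<le> t + r \<Longrightarrow>
         \<bar>(fwd_diff h ^^ Suc m) g x\<bar> \<le> C * h ^ Suc m"
      using fwd_diff_locally_bounded[OF Suc.prems(2,4) compact_imp_bounded[OF compact_continuous_image[OF
          continuous_on_subset[OF Suc.prems(3) r(2)] compact_Icc]] _ r(1,2)] by blast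
    define K where "K = C / exp (t - r)"
    have "diff_nonneg (Suc m) (\<lambda>x. 1 * g x + K * exp x) (ball t r)"
      unfolding K_def using C
      by (intro diff_nonneg_exp_perturb) (auto simp: ball_eq_greaterThanLessThan)
    moreover have "continuous_on (ball t r) (\<lambda>x. 1 * g x + K * exp x)"
      by (intro continuous_intros continuous_on_subset[OF Suc.prems(3) r(3)])
    ultimately obtain r' d where r': "0 < r'" "ball t r' \<subseteq> ball t r" "continuous_on (ball t r') d"
      "\<And>x. x \<in> ball t r' \<Longrightarrow> ((\<lambda>x. 1 * g x + K * exp x) has_real_derivative d x) (at x)"
      using Suc.IH[of "ball t r" "\<lambda>x. 1 * g x + K * exp x" t] r(1) by auto
    have "(g has_real_derivative d x - K * exp x) (at x)" if "x \<in> ball t r'" for x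
    proof -
      have "((\<lambda>x. (1 * g x + K * exp x) - K * exp x) has_real_derivative d x - K * exp x) (at x)"
        by (intro DERIV_diff[OF r'(4)[OF that]] DERIV_cmult DERIV_exp)
      then show ?thesis by simp
    qed
    moreover have "continuous_on (ball t r') (\<lambda>x. d x - K * exp x)"
      by (intro continuous_intros r'(3))
    moreover have "ball t r' \<subseteq> J" using r'(2) r(3) by (rule subset_trans)
    ultimately show ?case
      using r'(1) by (intro exI[of _ r'] exI[of _ "\<lambda>x. d x - K * exp x"]) simp
  next
    case base
    obtain R where R: "0 < R" "cball t R \<subseteq> J"
      using base(1,5) unfolding open_contains_cball by blast
    define r where "r = R / 3"
    have r: "0 < r" "{t - 3 * r..t + 3 * r} \<subseteq> J" "ball t r \<subseteq> J"
      using R by (auto simp: r_def cball_eq_atLeastAtMost ball_eq_greaterThanLessThan)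
    obtain C where C: "0 < C"
      "\<And>x h. 0 < h \<Longrightarrow> t - r \<le> x \<Longrightarrow> x + of_nat 2 * h \<le> t + r \<Longrightarrow>
         \<bar>(fwd_diff h ^^ 2) g x\<bar> \<le> C * h ^ 2"
      using fwd_diff_locally_bounded[OF base(2,4) compact_imp_bounded[OF compact_continuous_image[OF
          continuous_on_subset[OF base(3) r(2)] compact_Icc]] _ r(1,2)] by auto
    define K where "K = C / exp (t - r)"
    have conv: "convex_on (ball t r) (\<lambda>x. s * g x + K * exp x)" if s: "\<bar>s\<bar> = 1" for s
    proof (rule diff_nonneg_2_imp_convex_on)
      show "diff_nonneg 2 (\<lambda>x. s * g x + K * exp x) (ball t r)"
        unfolding K_def using C s
        by (intro diff_nonneg_exp_perturb) (auto simp: ball_eq_greaterThanLessThan)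
    qed (intro continuous_intros continuous_on_subset[OF base(3) r(3)] convex_ball)+
    \<comment> \<open>The signs \<open>s = 1\<close> and \<open>s = -1\<close> give two convex
      functions in which \<open>g\<close> cancels: their sum is the smooth function
      \<open>2 * K * exp x\<close>.\<close>
    obtain d where d: "\<And>x. x \<in> ball t r \<Longrightarrow> ((\<lambda>x. 1 * g x + K * exp x) has_real_derivative d x) (at x)"
      "continuous_on (ball t r) d"
    proof (rule convex_summand_C1[OF open_ball conv conv])
      show "(1 * g x + K * exp x) + ((-1) * g x + K * exp x) = 2 * K * exp x" for x by simp
      show "((\<lambda>x. 2 * K * exp x) has_real_derivative 2 * K * exp x) (at x)" for x
        by (auto intro!: derivative_eq_intros)
    qed (auto intro!: continuous_intros)
    have "(g has_real_derivative d x - K * exp x) (at x)" if "x \<in> ball t r" for x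
    proof -
      have "((\<lambda>x. (1 * g x + K * exp x) - K * exp x) has_real_derivative d x - K * exp x) (at x)"
        by (intro DERIV_diff[OF d(1)[OF that]] DERIV_cmult DERIV_exp)
      then show ?thesis by simp
    qed
    moreover have "continuous_on (ball t r) (\<lambda>x. d x - K * exp x)"
      by (intro continuous_intros d(2))
    ultimately show ?case
      using r by (intro exI[of _ r] exI[of _ "\<lambda>x. d x - K * exp x"]) simp
  qed
  then have loc: "\<exists>r. 0 < r \<and> g field_differentiable (at t) \<and> continuous_on (ball t r) (deriv g)"
    if t: "t \<in> J" for t
  proof -
    obtain r d where rd: "0 < r" "continuous_on (ball t r) d"
      "\<And>x. x \<in> ball t r \<Longrightarrow> (g has_real_derivative d x) (at x)"
      using local[OF t] by blast
    then have "continuous_on (ball t r) (deriv g)"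
      by (subst continuous_on_cong[OF refl, of _ _ d]) (auto intro: DERIV_imp_deriv)
    moreover have "g field_differentiable (at t)"
      using rd(3)[of t] rd(1) unfolding field_differentiable_def by auto
    ultimately show ?thesis using rd(1) by blast
  qed
  then show "\<forall>x\<in>J. g field_differentiable (at x)" by blast
  show "continuous_on J (deriv g)"
  proof (rule continuous_at_imp_continuous_on, rule ballI)
    fix t assume "t \<in> J"
    then obtain r where "0 < r" "continuous_on (ball t r) (deriv g)" using loc by blast
    then show "isCont (deriv g) t" using continuous_on_eq_continuous_at[OF open_ball] centre_in_ball by blast
  qed
qed

text \<open>The derivative is approximated by quotients of step \<open>h / N\<close>, a step
  commensurable with \<open>h\<close>. Then the \<open>m\<close>-th difference of step
  \<open>h\<close> decomposes into differences of step \<open>h / N\<close>, and together with the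
  quotient these are differences of order \<open>Suc m\<close> with one common step, to which the
  hypothesis applies. The sign survives the limit.\<close>

lemma diff_nonneg_deriv:
  assumes J: "open J" "convex J" and g: "\<And>x. x \<in> J \<Longrightarrow> g field_differentiable (at x)"
    and diff: "diff_nonneg (Suc m) g J"
  shows "diff_nonneg m (deriv g) J"
  unfolding diff_nonneg_def
proof (intro allI impI, elim conjE)
  fix x h assume h: "0 < h" and x: "x \<in> J" "x + real m * h \<in> J"
  obtain c :: "nat \<Rightarrow> real" where
    c: "\<And>g h x. (fwd_diff h ^^ m) g x = (\<Sum>i\<le>m. c i * g (x + of_nat i * h))"
    using fwd_diff_expansion[of m] by blast
  have step: "(\<lambda>N. h / real N) \<longlonglongrightarrow> 0" by (rule lim_const_over_n)
  have ne: "\<forall>\<^sub>F N in sequentially. h / real N \<noteq> 0"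
    using eventually_gt_at_top[of 0] by eventually_elim (use h in auto)
  have sub: "{x..x + real m * h} \<subseteq> J"
    using atLeastAtMost_subset_convex[OF J(2) x] .
  \<comment> \<open>At \<open>N = 0\<close> the quotient is 0 by the convention on division; only
    large \<open>N\<close> enter the limit.\<close>
  define G where "G N y = fwd_diff (h / real N) g y / (h / real N)" for N y
  have G: "(\<lambda>N. G N y) \<longlonglongrightarrow> deriv g y" if "y \<in> J" for y
  proof -
    have "(\<lambda>k. (g (y + k) - g y) / k) \<midarrow>0\<rightarrow> deriv g y"
      using g[OF that] unfolding DERIV_deriv_iff_field_differentiable[symmetric] DERIV_def .
    moreover have "filterlim (\<lambda>N. h / real N) (at 0) sequentially"
      unfolding filterlim_at using step ne by simp
    ultimately have "(\<lambda>N. (g (y + h / real N) - g y) / (h / real N)) \<longlonglongrightarrow> deriv g y"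
      by (rule filterlim_compose)
    then show ?thesis by (simp add: G_def fwd_diff_def)
  qed
  have lim: "(\<lambda>N. (fwd_diff h ^^ m) (G N) x) \<longlonglongrightarrow> (fwd_diff h ^^ m) (deriv g) x"
    unfolding c
  proof (intro tendsto_sum tendsto_mult tendsto_const G subsetD[OF sub])
    fix i assume "i \<in> {..m}"
    then show "x + real i * h \<in> {x..x + real m * h}" using h by (auto intro!: mult_right_mono)
  qed
  have "(\<lambda>N. x + real m * h + h / real N) \<longlonglongrightarrow> x + real m * h"
    using tendsto_add[OF tendsto_const[of "x + real m * h"] step] by simp
  \<comment> \<open>The quotient at the last node reaches beyond it by \<open>h / real N\<close>.
    Since \<open>J\<close> is open, this stays inside for large \<open>N\<close>.\<close>
  then have ev: "\<forall>\<^sub>F N in sequentially. x + real m * h + h / real N \<in> J"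
    using J(1) x(2) by (rule topological_tendstoD)
  have "\<forall>\<^sub>F N in sequentially. 0 \<le> (fwd_diff h ^^ m) (G N) x"
    using ev eventually_gt_at_top[of 0]
  proof eventually_elim
    case (elim N)
    define k where "k = h / real N"
    have k: "0 < k" "h = real N * k" using elim h by (auto simp: k_def)
    have sub': "{x..x + real m * h + k} \<subseteq> J"
      using atLeastAtMost_subset_convex[OF J(2) x(1)] elim(1) by (simp add: k_def)
    have "real N ^ m * 0 \<le> (fwd_diff (real N * k) ^^ m) (fwd_diff k g) x"
    proof (rule fwd_diff_coarse_ge)
      fix j assume j: "j \<le> m * (N - 1)"
      have "real j \<le> real (m * (N - 1))" using j by linarith
      also have "\<dots> = real m * (real N - 1)" using elim(2) by (simp add: of_nat_diff)
      finally have "real j * k \<le> (real m * (real N - 1)) * k"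
        using k by (intro mult_right_mono) auto
      then have jb: "real j * k + real (Suc m) * k \<le> real m * h + k"
        unfolding k(2) by (simp add: algebra_simps)
      have jnn: "0 \<le> real j * k" "0 \<le> real (Suc m) * k" using k(1) by simp_all
      have "0 \<le> (fwd_diff k ^^ Suc m) g (x + real j * k)"
        using jb jnn
        by (intro diff_nonnegD[OF diff k(1)] subsetD[OF sub'])
          (simp_all only: atLeastAtMost_iff, linarith+)
      then show "0 \<le> (fwd_diff k ^^ m) (fwd_diff k g) (x + real j * k)"
        by (simp only: fwd_diff_funpow_commute) simp
    qed
    then have "0 \<le> (fwd_diff h ^^ m) (fwd_diff k g) x / k"
      unfolding k(2) using k(1) by simp
    also have "\<dots> = (fwd_diff h ^^ m) (G N) x"
      unfolding c G_def k_def by (simp only: sum_divide_distrib times_divide_eq_right)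
    finally show ?case .
  qed
  then show "0 \<le> (fwd_diff h ^^ m) (deriv g) x"
    using tendsto_lowerbound[OF lim] by simp
qed

text \<open>Every differentiation lowers the order of the differences by one. The step to a
  continuous derivative works from order 3 upwards, so starting from order \<open>k + 2\<close> it
  can be made \<open>k\<close> times and leaves order 2, that is, convexity.\<close>

lemma diff_nonneg_imp_Ck:
  assumes J: "open J" "convex J" and "continuous_on J g" "diff_nonneg (k + 2) g J"
  shows "Ck_on k g J \<and> diff_nonneg 2 ((deriv ^^ k) g) J"
proof -
  have "(\<forall>i<j. \<forall>x\<in>J. (deriv ^^ i) g field_differentiable (at x)) \<and>
     (\<forall>i\<le>j. continuous_on J ((deriv ^^ i) g)) \<and> diff_nonneg (k - j + 2) ((deriv ^^ j) g) J"
    if "j \<le> k" for j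
    using that
  proof (induction j)
    case 0
    then show ?case using assms by simp
  next
    case (Suc j)
    have eq: "k - j + 2 = Suc (k - Suc j + 2)" using Suc.prems by simp
    have IH: "continuous_on J ((deriv ^^ j) g)" "diff_nonneg (Suc (k - Suc j + 2)) ((deriv ^^ j) g) J"
      using Suc.IH Suc.prems unfolding eq by simp_all
    have new: "\<forall>x\<in>J. (deriv ^^ j) g field_differentiable (at x)" "continuous_on J ((deriv ^^ Suc j) g)"
      using diff_nonneg_imp_C1[OF _ J IH] by simp_all
    moreover have "diff_nonneg (k - Suc j + 2) ((deriv ^^ Suc j) g) J"
      using diff_nonneg_deriv[OF J _ IH(2)] new by simp
    ultimately show ?case using Suc by (simp add: less_Suc_eq le_Suc_eq)
  qed
  from this[of k] show ?thesis by (simp add: Ck_on_def numeral_2_eq_2)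
qed

section \<open>Composition with the logarithm\<close>

text \<open>This recursion lets induction on \<open>k\<close> pass from \<open>f\<close> to
  \<open>deriv f\<close>; continuity of \<open>f\<close> itself follows from
  differentiability.\<close>

lemma Ck_on_Suc_iff:
  "Ck_on (Suc k) f S \<longleftrightarrow> (\<forall>x\<in>S. f field_differentiable (at x)) \<and> Ck_on k (deriv f) S"
proof -
  have "continuous_on S f" if "\<forall>x\<in>S. f field_differentiable (at x)"
    using that by (simp add: continuous_at_imp_continuous_on field_differentiable_imp_continuous_at)
  moreover have "(\<forall>j\<le>Suc k. P j) \<longleftrightarrow> P 0 \<and> (\<forall>j\<le>k. P (Suc j))" for P :: "nat \<Rightarrow> bool"
    using All_less_Suc2[of "Suc k" P] by (simp add: less_Suc_eq_le)
  ultimately show ?thesis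
    unfolding Ck_on_def by (auto simp: All_less_Suc2 funpow_swap1)
qed

lemma Ck_on_Suc_imp: "Ck_on (Suc k) f S \<Longrightarrow> Ck_on k f S"
  by (simp add: Ck_on_def)

lemma Ck_on_cong:
  assumes S: "open S" and eq: "\<And>x. x \<in> S \<Longrightarrow> f x = g x" and f: "Ck_on k f S"
  shows "Ck_on k g S"
  using eq f
proof (induction k arbitrary: f g)
  case 0
  then show ?case by (simp add: Ck_on_def cong: continuous_on_cong)
next
  case (Suc k)
  have der: "(g has_real_derivative deriv f x) (at x)" if x: "x \<in> S" for x
  proof -
    have "(f has_real_derivative deriv f x) (at x)"
      using Suc.prems(2) x by (simp add: Ck_on_Suc_iff DERIV_deriv_iff_field_differentiable)
    then show ?thesis
      using Suc.prems(1) by (rule has_field_derivative_transform_within_open[OF _ S x])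
  qed
  have "Ck_on k (deriv g) S"
    by (rule Suc.IH[of "deriv f"])
      (use Suc.prems(2) in \<open>simp_all add: Ck_on_Suc_iff DERIV_imp_deriv[OF der]\<close>)
  then show ?case using der by (auto simp: Ck_on_Suc_iff field_differentiable_def)
qed

lemma Ck_on_SucI:
  assumes S: "open S" and "\<And>x. x \<in> S \<Longrightarrow> (f has_real_derivative f' x) (at x)" "Ck_on k f' S"
  shows "Ck_on (Suc k) f S"
proof -
  have "Ck_on k (deriv f) S"
    by (rule Ck_on_cong[OF S _ assms(3)]) (simp add: DERIV_imp_deriv[OF assms(2)])
  then show ?thesis using assms(2) by (auto simp: Ck_on_Suc_iff field_differentiable_def)
qed

lemma Ck_on_add_cmult:
  assumes S: "open S" and "Ck_on k f S" "Ck_on k g S"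
  shows "Ck_on k (\<lambda>x. f x + c * g x) S"
  using assms(2,3)
proof (induction k arbitrary: f g)
  case 0
  then show ?case by (simp add: Ck_on_def continuous_intros)
next
  case (Suc k)
  show ?case
  proof (rule Ck_on_SucI[OF S])
    show "((\<lambda>x. f x + c * g x) has_real_derivative deriv f x + c * deriv g x) (at x)"
      if "x \<in> S" for x
      using Suc.prems that
      by (intro DERIV_add DERIV_cmult) (simp_all add: Ck_on_Suc_iff DERIV_deriv_iff_field_differentiable)
  qed (use Suc in \<open>simp add: Ck_on_Suc_iff\<close>)
qed

text \<open>The factor \<open>inverse x ^ i\<close> closes the induction: the derivative has the
  same form, with \<open>i\<close> raised by one and \<open>g\<close> replaced by \<open>g'\<close>,
  the function \<open>deriv g\<close> minus \<open>i\<close> times \<open>g\<close>. The case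
  \<open>i = 0\<close> is the composition itself.\<close>

lemma Ck_on_comp_ln:
  assumes I: "open I" "I \<subseteq> {0<..}" and J: "open J" "ln ` I \<subseteq> J" and "Ck_on k g J"
  shows "Ck_on k (\<lambda>x. g (ln x) * inverse x ^ i) I"
  using assms(5)
proof (induction k arbitrary: g i)
  case 0
  have "continuous_on I (\<lambda>x. g (ln x))"
  proof (rule continuous_on_compose2[of J g])
    show "continuous_on J g" using 0 by (simp add: Ck_on_def)
    show "continuous_on I ln" using I(2) by (intro continuous_on_ln continuous_on_id) auto
  qed (rule J(2))
  moreover have "continuous_on I (\<lambda>x. inverse x ^ i)"
    using I(2) by (intro continuous_on_power continuous_on_inverse continuous_on_id) auto
  ultimately show ?case by (simp add: Ck_on_def continuous_on_mult)
next
  case (Suc k)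
  define g' where "g' y = deriv g y + (- of_nat i) * g y" for y
  have "Ck_on k g' J"
    unfolding g'_def using Suc.prems Ck_on_Suc_imp[OF Suc.prems]
    by (intro Ck_on_add_cmult[OF J(1)]) (simp_all add: Ck_on_Suc_iff)
  then have "Ck_on k (\<lambda>x. g' (ln x) * inverse x ^ Suc i) I" by (rule Suc.IH)
  moreover have "((\<lambda>x. g (ln x) * inverse x ^ i) has_real_derivative g' (ln x) * inverse x ^ Suc i) (at x)"
    if x: "x \<in> I" for x
  proof -
    have x0: "0 < x" using x I by auto
    have "ln x \<in> J" using x J by auto
    then have "(g has_real_derivative deriv g (ln x)) (at (ln x))"
      using Suc.prems by (simp add: Ck_on_Suc_iff DERIV_deriv_iff_field_differentiable)
    from DERIV_chain2[OF this DERIV_ln[OF x0]]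
    have "((\<lambda>x. g (ln x)) has_real_derivative deriv g (ln x) * inverse x) (at x)" .
    moreover have "((\<lambda>x. inverse x ^ i) has_real_derivative - of_nat i * inverse x ^ Suc i) (at x)"
    proof (cases i)
      case (Suc l)
      have "((\<lambda>x. inverse x ^ i) has_real_derivative of_nat i * (- (inverse x ^ Suc (Suc 0)) * inverse x ^ (i - Suc 0))) (at x)"
        using x0 by (intro DERIV_power DERIV_inverse) simp
      then show ?thesis by (simp add: Suc algebra_simps)
    qed simp
    ultimately have "((\<lambda>x. g (ln x) * inverse x ^ i) has_real_derivative
        deriv g (ln x) * inverse x * inverse x ^ i + (- of_nat i * inverse x ^ Suc i) * g (ln x)) (at x)"
      by (rule DERIV_mult)
    then show ?thesis by (simp add: g'_def algebra_simps)
  qed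
  ultimately show ?case by (intro Ck_on_SucI[OF I(1)])
qed

section \<open>Test functions and distributional derivatives\<close>

lemma compact_subset_greaterThanLessThan:
  fixes J :: "real set"
  assumes J: "open J" "J \<noteq> {}" and K: "compact K" "K \<subseteq> J"
  obtains a b where "a \<in> J" "b \<in> J" "a < b" "K \<subseteq> {a<..<b}"
proof -
  obtain c where c: "c \<in> J" using J by blast
  \<comment> \<open>The added point makes the set nonempty, so that its least and greatest elements
    exist.\<close>
  have K': "compact (insert c K)" "insert c K \<noteq> {}" using K by auto
  obtain l where l: "l \<in> insert c K" "\<And>t. t \<in> insert c K \<Longrightarrow> l \<le> t"
    using compact_attains_inf[OF K'] by blast
  obtain u where u: "u \<in> insert c K" "\<And>t. t \<in> insert c K \<Longrightarrow> t \<le> u"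
    using compact_attains_sup[OF K'] by blast
  have "l \<in> J" "u \<in> J" using l(1) u(1) c K by auto
  then obtain d e where d: "0 < d" "cball l d \<subseteq> J" and e: "0 < e" "cball u e \<subseteq> J"
    using J(1) unfolding open_contains_cball by meson
  show ?thesis
  proof
    show "l - d \<in> J" "u + e \<in> J" using d e by (auto simp: subset_iff dist_real_def)
    show "l - d < u + e" using l(2)[OF u(1)] d e by linarith
    show "K \<subseteq> {l - d<..<u + e}" using l(2) u(2) d e by (force simp: subset_iff)
  qed
qed

lemma test_function_higher_differentiable:
  "test_function J \<phi> \<Longrightarrow> (deriv ^^ k) \<phi> field_differentiable (at x)"
  unfolding test_function_def by blast

lemma test_function_has_deriv:
  "test_function J \<phi> \<Longrightarrow> (\<phi> has_real_derivative deriv \<phi> x) (at x)"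
  using test_function_higher_differentiable[of J \<phi> 0 x]
  by (simp add: DERIV_deriv_iff_field_differentiable)

lemma test_function_zero: "test_function J \<phi> \<Longrightarrow> x \<notin> closure {x. \<phi> x \<noteq> 0} \<Longrightarrow> \<phi> x = 0"
  using closure_subset[of "{x. \<phi> x \<noteq> 0}"] by blast

lemma test_function_deriv:
  assumes "test_function J \<phi>"
  shows "test_function J (deriv \<phi>)"
proof -
  let ?K = "closure {x. \<phi> x \<noteq> 0}"
  have "deriv \<phi> x = 0" if "x \<notin> ?K" for x
  proof -
    \<comment> \<open>Outside its support \<open>\<phi>\<close> vanishes on an open set, hence so
      does its derivative.\<close>
    have "((\<lambda>_. 0) has_real_derivative deriv \<phi> x) (at x)"
    proof (rule has_field_derivative_transform_within_open[OF test_function_has_deriv[OF assms]])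
      show "x \<in> - ?K" using that by simp
      show "\<phi> y = 0" if "y \<in> - ?K" for y
        using that by (intro test_function_zero[OF assms]) simp
    qed (rule open_Compl[OF closed_closure])
    then show ?thesis by (metis DERIV_const DERIV_unique)
  qed
  then have sub: "closure {x. deriv \<phi> x \<noteq> 0} \<subseteq> ?K"
    by (intro closure_minimal) auto
  have "compact (closure {x. deriv \<phi> x \<noteq> 0})"
    using assms compact_Int_closed[of ?K "closure {x. deriv \<phi> x \<noteq> 0}"] sub
    unfolding test_function_def by (simp add: Int_absorb1)
  moreover have "(deriv ^^ k) (deriv \<phi>) field_differentiable (at x)" for k x
    using test_function_higher_differentiable[OF assms, of "Suc k" x] by (simp add: funpow_swap1)
  ultimately show ?thesis using assms sub unfolding test_function_def by blast
qed

lemma test_function_interval: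
  assumes J: "open J" "J \<noteq> {}" and \<phi>: "test_function J \<phi>"
  obtains a b where "a \<in> J" "b \<in> J" "a < b" "\<And>t. t \<notin> {a<..<b} \<Longrightarrow> \<phi> t = 0"
    "\<And>t. t \<notin> {a<..<b} \<Longrightarrow> deriv \<phi> t = 0"
proof -
  have "compact (closure {x. \<phi> x \<noteq> 0} \<union> closure {x. deriv \<phi> x \<noteq> 0})"
    "closure {x. \<phi> x \<noteq> 0} \<union> closure {x. deriv \<phi> x \<noteq> 0} \<subseteq> J"
    using \<phi> test_function_deriv[OF \<phi>] unfolding test_function_def by auto
  then obtain a b where ab: "a \<in> J" "b \<in> J" "a < b"
    "closure {x. \<phi> x \<noteq> 0} \<union> closure {x. deriv \<phi> x \<noteq> 0} \<subseteq> {a<..<b}"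
    using compact_subset_greaterThanLessThan[OF J] by metis
  have "\<phi> t = 0" "deriv \<phi> t = 0" if "t \<notin> {a<..<b}" for t
    using ab(4) that test_function_zero[OF \<phi>] test_function_zero[OF test_function_deriv[OF \<phi>]]
    by blast+
  with ab that show ?thesis by blast
qed

section \<open>Integration by parts through Fubini's theorem\<close>

lemma integrable_lborel_pair_mult:
  fixes u v :: "real \<Rightarrow> real"
  assumes u: "integrable lborel u" and v: "integrable lborel v"
  shows "integrable (lborel \<Otimes>\<^sub>M lborel) (\<lambda>(x, y). u x * v y)"
proof (rule lborel_pair.Fubini_integrable)
  show "(\<lambda>(x, y). u x * v y) \<in> borel_measurable (lborel \<Otimes>\<^sub>M lborel)"
    using u v by measurable
  have "integrable lborel (\<lambda>x. \<bar>u x\<bar> * (\<integral>y. \<bar>v y\<bar> \<partial>lborel))"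
    using u by (intro integrable_mult_left integrable_abs)
  then show "integrable lborel (\<lambda>x. \<integral>y. norm (case (x, y) of (x, y) \<Rightarrow> u x * v y) \<partial>lborel)"
    by (simp add: abs_mult)
  show "AE x in lborel. integrable lborel (\<lambda>y. case (x, y) of (x, y) \<Rightarrow> u x * v y)"
    using v by simp
qed

text \<open>Since \<open>\<phi> b = 0\<close>, the value \<open>\<phi> (q y)\<close> is minus the
  integral of \<open>\<phi>'\<close> from \<open>q y\<close> to \<open>b\<close>; exchanging the
  integrals over \<open>y\<close> and \<open>t\<close> gives the formula. It is used twice: with
  \<open>q\<close> the identity for functions that have an antiderivative, and with \<open>q\<close>
  a generalized inverse for the measure of a monotone function.\<close>

lemma integral_comp_eq_integral_deriv:
  fixes W q \<phi> \<phi>' :: "real \<Rightarrow> real"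
  assumes W: "integrable lborel W" and q: "q \<in> borel_measurable borel"
    and \<phi>: "\<And>t. (\<phi> has_real_derivative \<phi>' t) (at t)" and \<phi>': "continuous_on UNIV \<phi>'"
    and b: "\<phi> b = 0" and qab: "\<And>y. W y \<noteq> 0 \<Longrightarrow> q y \<in> {a..b}"
  shows "(\<integral>y. W y * \<phi> (q y) \<partial>lborel) =
    - (\<integral>t. indicator {a..b} t * \<phi>' t * (\<integral>y. W y * (if q y \<le> t then 1 else 0) \<partial>lborel) \<partial>lborel)"
proof -
  define v where "v t = indicator {a..b} t * \<phi>' t" for t
  have v: "integrable lborel v"
    using borel_integrable_atLeastAtMost'[OF continuous_on_subset[OF \<phi>' subset_UNIV]]
    unfolding v_def[abs_def] set_integrable_def by simp
  have [measurable]: "W \<in> borel_measurable borel" "v \<in> borel_measurable borel"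
    using W v by auto
  note [measurable] = q
  have int: "integrable (lborel \<Otimes>\<^sub>M lborel) (\<lambda>(y, t). W y * v t * (if q y \<le> t then 1 else 0))"
    by (rule Bochner_Integration.integrable_bound[OF integrable_lborel_pair_mult[OF W v]])
      (auto simp: abs_mult split: prod.splits intro!: AE_I2)
  have inner: "(\<integral>t. W y * v t * (if q y \<le> t then 1 else 0) \<partial>lborel) = - (W y * \<phi> (q y))" for y
  proof (cases "W y = 0")
    case False
    from qab[OF this] have qy: "a \<le> q y" "q y \<le> b" by auto
    have "(\<integral>t. W y * v t * (if q y \<le> t then 1 else 0) \<partial>lborel) =
        (\<integral>t. W y * (\<phi>' t * indicator {q y..b} t) \<partial>lborel)"
      using qy by (intro Bochner_Integration.integral_cong) (auto simp: v_def indicator_def)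
    also have "\<dots> = W y * (\<phi> b - \<phi> (q y))"
      using integral_FTC_Icc_real[OF qy(2) \<phi>] \<phi>' by (simp add: continuous_on_eq_continuous_at)
    finally show ?thesis using b by simp
  qed simp
  have "- (\<integral>y. W y * \<phi> (q y) \<partial>lborel) = (\<integral>y. \<integral>t. W y * v t * (if q y \<le> t then 1 else 0) \<partial>lborel \<partial>lborel)"
    by (simp add: inner)
  also have "\<dots> = (\<integral>t. \<integral>y. W y * v t * (if q y \<le> t then 1 else 0) \<partial>lborel \<partial>lborel)"
    by (rule lborel_pair.Fubini_integral[OF int, symmetric])
  also have "\<dots> = (\<integral>t. v t * (\<integral>y. W y * (if q y \<le> t then 1 else 0) \<partial>lborel) \<partial>lborel)"
    by (simp add: mult.assoc mult.left_commute flip: integral_mult_right_zero)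
  finally show ?thesis by (simp add: v_def)
qed

text \<open>Distributions are defined by the complete Lebesgue measure on \<open>J\<close>, while
  the Fubini argument runs on \<open>lborel\<close>. The two integrals agree for a test function
  supported in a compact interval on which \<open>u\<close> is Borel.\<close>

lemma distr_of_fun_eq_integral:
  assumes sub: "{a..b} \<subseteq> J" and u: "set_borel_measurable borel {a..b} u"
    and \<phi>: "continuous_on UNIV \<phi>" and zero: "\<And>t. t \<notin> {a..b} \<Longrightarrow> \<phi> t = 0"
  shows "distr_of_fun J u \<phi> = (\<integral>t. indicator {a..b} t * u t * \<phi> t \<partial>lborel)"
proof -
  have [measurable]: "\<phi> \<in> borel_measurable borel"
    using \<phi> by (rule borel_measurable_continuous_onI)
  have [measurable]: "(\<lambda>t. indicator {a..b} t * u t) \<in> borel_measurable borel"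
    using u unfolding set_borel_measurable_def by simp
  have "distr_of_fun J u \<phi> = (\<integral>t. indicator {a..b} t * u t * \<phi> t \<partial>lebesgue)"
    unfolding distr_of_fun_def set_lebesgue_integral_def
    using sub zero by (intro Bochner_Integration.integral_cong) (auto simp: indicator_def)
  also have "\<dots> = (\<integral>t. indicator {a..b} t * u t * \<phi> t \<partial>lborel)"
    by (rule integral_completion) measurable
  finally show ?thesis .
qed

text \<open>The fundamental theorem of calculus in integrated form. It also covers a discontinuous
  \<open>h\<close>, such as the right derivative of a convex function.\<close>

definition antiderivative_on :: "real set \<Rightarrow> (real \<Rightarrow> real) \<Rightarrow> (real \<Rightarrow> real) \<Rightarrow> bool" where
  "antiderivative_on J H h \<longleftrightarrow> continuous_on J H \<and>
     (\<forall>a\<in>J. \<forall>b\<in>J. a \<le> b \<longrightarrow> set_integrable lborel {a..b} h \<and> (LINT t:{a..b}|lborel. h t) = H b - H a)"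

text \<open>Integration by parts with \<open>q\<close> the identity and \<open>W\<close> the
  restriction of \<open>h\<close> to \<open>{a..b}\<close>. The inner integral is
  \<open>H t - H a\<close>, and the constant \<open>H a\<close> drops out because
  \<open>deriv \<phi>\<close> has integral \<open>\<phi> b - \<phi> a = 0\<close>.\<close>

lemma distr_deriv_antiderivative:
  assumes J: "open J" "convex J" "J \<noteq> {}" and anti: "antiderivative_on J H h"
  shows "distr_eq J (distr_deriv (distr_of_fun J H)) (distr_of_fun J h)"
  unfolding distr_eq_def distr_deriv_def
proof (intro allI impI)
  fix \<phi> assume \<phi>: "test_function J \<phi>"
  note \<phi>' = test_function_deriv[OF \<phi>]
  obtain a b where ab: "a \<in> J" "b \<in> J" "a < b" and zero: "\<And>t. t \<notin> {a<..<b} \<Longrightarrow> \<phi> t = 0"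
    "\<And>t. t \<notin> {a<..<b} \<Longrightarrow> deriv \<phi> t = 0"
    using test_function_interval[OF J(1,3) \<phi>] by metis
  have sub: "{a..b} \<subseteq> J" using atLeastAtMost_subset_convex[OF J(2) ab(1,2)] .
  have cont: "continuous_on UNIV \<phi>" "continuous_on UNIV (deriv \<phi>)"
    using test_function_has_deriv[OF \<phi>] test_function_has_deriv[OF \<phi>']
    by (auto intro: has_real_derivative_imp_continuous_on)
  have h: "set_integrable lborel {x..y} h" "(LINT t:{x..y}|lborel. h t) = H y - H x"
    if "x \<in> J" "y \<in> J" "x \<le> y" for x y
    using anti that unfolding antiderivative_on_def by auto
  have Hcont: "continuous_on {a..b} H"
    using anti sub continuous_on_subset unfolding antiderivative_on_def by blast
  define W where "W t = indicator {a..b} t * h t" for t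
  have W: "integrable lborel W"
    using h(1)[OF ab(1,2)] ab(3) unfolding W_def[abs_def] set_integrable_def by simp
  have inner: "(\<integral>y. W y * (if y \<le> t then 1 else 0) \<partial>lborel) = H t - H a" if t: "t \<in> {a..b}" for t
  proof -
    have "(\<integral>y. W y * (if y \<le> t then 1 else 0) \<partial>lborel) = (LINT y:{a..t}|lborel. h y)"
      unfolding set_lebesgue_integral_def W_def
      using t by (intro Bochner_Integration.integral_cong) (auto simp: indicator_def)
    then show ?thesis using h(2)[of a t] t ab sub by auto
  qed
  have int1: "integrable lborel (\<lambda>t. indicator {a..b} t * deriv \<phi> t * H t)"
    using borel_integrable_atLeastAtMost'[of a b "\<lambda>t. deriv \<phi> t * H t"] Hcont
      continuous_on_subset[OF cont(2) subset_UNIV]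
    unfolding set_integrable_def by (simp add: continuous_on_mult mult.assoc)
  have int2: "integrable lborel (\<lambda>t. indicator {a..b} t * deriv \<phi> t * H a)"
    using borel_integrable_atLeastAtMost'[of a b "\<lambda>t. deriv \<phi> t * H a"]
      continuous_on_subset[OF cont(2) subset_UNIV]
    unfolding set_integrable_def by (simp add: continuous_on_mult mult.assoc)
  have zero_int: "(\<integral>t. indicator {a..b} t * deriv \<phi> t * H a \<partial>lborel) = 0"
    using integral_FTC_Icc_real[of a b \<phi> "deriv \<phi>"] ab test_function_has_deriv[OF \<phi>] cont(2) zero(1)[of a] zero(1)[of b]
    by (simp add: continuous_on_eq_continuous_at mult.commute)
  have "distr_of_fun J h \<phi> = (\<integral>t. W t * \<phi> t \<partial>lborel)"
    unfolding W_def using h(1)[OF ab(1,2)] ab(3) zero(1)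
    by (intro distr_of_fun_eq_integral[OF sub _ cont(1)])
      (auto simp: set_integrable_def set_borel_measurable_def)
  also have "\<dots> = - (\<integral>t. indicator {a..b} t * deriv \<phi> t * (\<integral>y. W y * (if y \<le> t then 1 else 0) \<partial>lborel) \<partial>lborel)"
    using zero(1)[of b]
    by (intro integral_comp_eq_integral_deriv[OF W _ test_function_has_deriv[OF \<phi>] cont(2)])
      (auto simp: W_def indicator_def split: if_splits)
  also have "(\<integral>t. indicator {a..b} t * deriv \<phi> t * (\<integral>y. W y * (if y \<le> t then 1 else 0) \<partial>lborel) \<partial>lborel) =
      (\<integral>t. indicator {a..b} t * deriv \<phi> t * H t - indicator {a..b} t * deriv \<phi> t * H a \<partial>lborel)"
  proof (rule Bochner_Integration.integral_cong[OF refl])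
    fix t
    show "indicator {a..b} t * deriv \<phi> t * (\<integral>y. W y * (if y \<le> t then 1 else 0) \<partial>lborel) =
        indicator {a..b} t * deriv \<phi> t * H t - indicator {a..b} t * deriv \<phi> t * H a"
      by (cases "t \<in> {a..b}") (simp_all add: inner right_diff_distrib)
  qed
  also have "\<dots> = (\<integral>t. indicator {a..b} t * deriv \<phi> t * H t \<partial>lborel)"
    using int1 int2 zero_int by simp
  also have "\<dots> = (\<integral>t. indicator {a..b} t * H t * deriv \<phi> t \<partial>lborel)"
    by (simp add: ac_simps)
  also have "\<dots> = distr_of_fun J H (deriv \<phi>)"
    using borel_integrable_atLeastAtMost'[OF Hcont] zero(2)
    by (intro distr_of_fun_eq_integral[OF sub _ cont(2), symmetric])
      (auto simp: set_integrable_def set_borel_measurable_def)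
  finally show "- distr_of_fun J H (deriv \<phi>) = distr_of_fun J h \<phi>" by simp
qed

lemma antiderivative_on_C1:
  assumes J: "open J" "convex J" and H: "\<And>x. x \<in> J \<Longrightarrow> (H has_real_derivative h x) (at x)"
    and h: "continuous_on J h"
  shows "antiderivative_on J H h"
  unfolding antiderivative_on_def
proof (intro conjI ballI impI)
  show "continuous_on J H" using H by (rule has_real_derivative_imp_continuous_on)
  fix a b :: real assume ab: "a \<in> J" "b \<in> J" "a \<le> b"
  have sub: "{a..b} \<subseteq> J" using atLeastAtMost_subset_convex[OF J(2) ab(1,2)] .
  show "set_integrable lborel {a..b} h"
    by (rule borel_integrable_atLeastAtMost'[OF continuous_on_subset[OF h sub]])
  have "(\<integral>x. h x * indicator {a..b} x \<partial>lborel) = H b - H a"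
    using sub H h J(1) ab(3) by (intro integral_FTC_Icc_real) (auto simp: continuous_on_eq_continuous_at)
  then show "(LINT t:{a..b}|lborel. h t) = H b - H a"
    unfolding set_lebesgue_integral_def by (simp add: mult.commute)
qed

section \<open>Convex functions\<close>

text \<open>The second property is right continuity of the monotone function \<open>h\<close>, in
  the form that its generalized inverse requires. Some chord from \<open>x\<close> to a point
  \<open>t\<close> on the right has slope below \<open>y\<close>. By continuity of \<open>H\<close>
  so does the chord from \<open>s\<close> to the same \<open>t\<close> for \<open>s\<close> slightly
  to the right of \<open>x\<close>, and \<open>h s\<close> is at most that slope.\<close>

lemma convex_on_right_derivative:
  fixes H :: "real \<Rightarrow> real"
  assumes J: "open J" and H: "convex_on J H"
  obtains h where "\<And>x y. x \<in> J \<Longrightarrow> y \<in> J \<Longrightarrow> H x + h x * (y - x) \<le> H y"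
    and "\<And>x y. x \<in> J \<Longrightarrow> h x < y \<Longrightarrow> \<exists>t\<in>J. x < t \<and> h t < y"
proof -
  define h where "h x = Inf ((\<lambda>t. (H x - H t) / (x - t)) ` ({x<..} \<inter> J))" for x
  have sub: "H x + h x * (y - x) \<le> H y" if "x \<in> J" "y \<in> J" for x y
    using convex_le_Inf_differential[OF H, of x y] J that by (simp add: h_def interior_open)
  moreover have "\<exists>t\<in>J. x < t \<and> h t < y" if x: "x \<in> J" and y: "h x < y" for x y
  proof -
    obtain e where e: "0 < e" "ball x e \<subseteq> J" using J x openE by blast
    have "x + e / 2 \<in> {x<..} \<inter> J" using e by (auto simp: subset_iff dist_real_def)
    then have "(\<lambda>t. (H x - H t) / (x - t)) ` ({x<..} \<inter> J) \<noteq> {}" by blast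
    from cInf_lessD[OF this, of y] y obtain t where t: "x < t" "t \<in> J" "(H x - H t) / (x - t) < y"
      unfolding h_def by auto
    have "isCont H x"
      using convex_on_continuous[OF J H] J x by (simp add: continuous_on_eq_continuous_at)
    then have "isCont (\<lambda>s. (H s - H t) / (s - t)) x"
      using t(1) by (intro continuous_intros) auto
    then have "\<forall>\<^sub>F s in at x. (H s - H t) / (s - t) < y"
      unfolding isCont_def using t(3) by (rule order_tendstoD)
    then have "\<forall>\<^sub>F s in at_right x. (H s - H t) / (s - t) < y"
      by (rule eventually_at_split[THEN iffD1, THEN conjunct2])
    moreover have "\<forall>\<^sub>F s in at_right x. s \<in> {x<..<min t (x + e)}"
      using t(1) e(1) by (intro eventually_at_right_real) auto
    ultimately obtain s where s: "(H s - H t) / (s - t) < y" "x < s" "s < t" "s < x + e"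
      using eventually_happens'[OF trivial_limit_at_right_real eventually_conj] by fastforce
    have sJ: "s \<in> J" using e s by (auto simp: subset_iff dist_real_def)
    have "h s \<le> (H s - H t) / (s - t)"
      using sub[OF sJ t(2)] s(3) by (simp add: field_simps)
    then show ?thesis using s sJ by force
  qed
  ultimately show ?thesis using that by blast
qed

lemma subgradient_mono_on:
  fixes H h :: "real \<Rightarrow> real"
  assumes "\<And>x y. x \<in> J \<Longrightarrow> y \<in> J \<Longrightarrow> H x + h x * (y - x) \<le> H y"
  shows "mono_on J h"
proof (rule mono_onI)
  fix x y assume xy: "x \<in> J" "y \<in> J" "x \<le> y"
  have "0 \<le> (h y - h x) * (y - x)"
    using assms[OF xy(1,2)] assms[OF xy(2,1)] by (simp add: algebra_simps)
  then show "h x \<le> h y" using xy(3) by (cases "x = y") (auto simp: zero_le_mult_iff)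
qed

lemma set_integrable_mono_on:
  fixes h :: "real \<Rightarrow> real"
  assumes h: "mono_on {a..b} h"
  shows "set_integrable lborel {a..b} h"
proof -
  have "(\<lambda>x. indicator {a..b} x *\<^sub>R h x) \<in> borel_measurable borel"
    using borel_measurable_mono_on_fnc[OF h] by (simp add: borel_measurable_restrict_space_iff)
  then have "integrable lborel (\<lambda>x. indicator {a..b} x *\<^sub>R (indicator {a..b} x *\<^sub>R h x))"
  proof (intro integrableI_bounded_set_indicator[where B = "\<bar>h a\<bar> + \<bar>h b\<bar>"] AE_I2 impI)
    show "norm (indicator {a..b} x *\<^sub>R h x) \<le> \<bar>h a\<bar> + \<bar>h b\<bar>" if "x \<in> {a..b}" for x
      using mono_onD[OF h, of a x] mono_onD[OF h, of x b] that by auto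
  qed (auto simp: emeasure_lborel_Icc_eq)
  moreover have "(\<lambda>x. indicator {a..b} x *\<^sub>R (indicator {a..b} x *\<^sub>R h x)) = (\<lambda>x. indicator {a..b} x *\<^sub>R h x)"
    by (auto simp: indicator_def)
  ultimately show ?thesis unfolding set_integrable_def by simp
qed

text \<open>Cut \<open>{a..b}\<close> into \<open>N\<close> equal pieces. The increments of
  \<open>v\<close> telescope, so the total change of \<open>D\<close> is at most a constant divided
  by \<open>N\<close>.\<close>

lemma constant_of_mono_bound:
  fixes D v :: "real \<Rightarrow> real"
  assumes bd: "\<And>x y. a \<le> x \<Longrightarrow> x \<le> y \<Longrightarrow> y \<le> b \<Longrightarrow> \<bar>D y - D x\<bar> \<le> (y - x) * (v y - v x)"
    and ab: "a \<le> b"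
  shows "D b = D a"
proof -
  have "\<bar>D b - D a\<bar> \<le> (b - a) * (v b - v a) / real N" if N: "0 < N" for N :: nat
  proof -
    define p where "p i = a + real i * ((b - a) / real N)" for i
    have p: "p 0 = a" "p N = b" using N by (simp_all add: p_def)
    have step: "p (Suc i) - p i = (b - a) / real N" for i
      unfolding p_def of_nat_Suc distrib_right by simp
    have "\<bar>D (p (Suc i)) - D (p i)\<bar> \<le> (b - a) / real N * (v (p (Suc i)) - v (p i))" if i: "i < N" for i
    proof -
      have "real (Suc i) * ((b - a) / real N) \<le> real N * ((b - a) / real N)"
        using i ab by (intro mult_right_mono) auto
      then have "p (Suc i) \<le> b" using p(2) by (simp add: p_def)
      moreover have "a \<le> p i" using ab by (simp add: p_def)
      moreover have "0 \<le> (b - a) / real N" using ab by simp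
      then have "p i \<le> p (Suc i)" using step[of i] by linarith
      ultimately show ?thesis using bd[of "p i" "p (Suc i)"] by (simp add: step)
    qed
    then have "(\<Sum>i<N. \<bar>D (p (Suc i)) - D (p i)\<bar>) \<le> (\<Sum>i<N. (b - a) / real N * (v (p (Suc i)) - v (p i)))"
      by (intro sum_mono) simp
    also have "\<dots> = (b - a) / real N * (v b - v a)"
      by (simp only: sum_distrib_left[symmetric] sum_lessThan_telescope[of "\<lambda>i. v (p i)" N] p)
    finally have "(\<Sum>i<N. \<bar>D (p (Suc i)) - D (p i)\<bar>) \<le> (b - a) / real N * (v b - v a)" .
    moreover have "D b - D a = (\<Sum>i<N. D (p (Suc i)) - D (p i))"
      using sum_lessThan_telescope[of "\<lambda>i. D (p i)" N] by (simp add: p)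
    ultimately show ?thesis
      using sum_abs[of "\<lambda>i. D (p (Suc i)) - D (p i)" "{..<N}"]
      by (simp only: times_divide_eq_left)
  qed
  moreover have "(\<lambda>N. (b - a) * (v b - v a) / real N) \<longlonglongrightarrow> 0" by (rule lim_const_over_n)
  ultimately have "\<bar>D b - D a\<bar> \<le> 0"
    by (intro LIMSEQ_le_const[of _ 0]) (auto intro!: exI[of _ 1])
  then show ?thesis by simp
qed

text \<open>Over \<open>{x..y}\<close> both the integral of \<open>h\<close> and the increment of
  \<open>H\<close> lie between \<open>h x * (y - x)\<close> and \<open>h y * (y - x)\<close>. Their
  difference is therefore controlled by the increment of \<open>h\<close>, and
  \<open>constant_of_mono_bound\<close> applies with \<open>v = h\<close>.\<close>

lemma antiderivative_on_subgradient:
  assumes J: "open J" "convex J" and H: "convex_on J H"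
    and h: "\<And>x y. x \<in> J \<Longrightarrow> y \<in> J \<Longrightarrow> H x + h x * (y - x) \<le> H y"
  shows "antiderivative_on J H h"
  unfolding antiderivative_on_def
proof (intro conjI ballI impI)
  show "continuous_on J H" using convex_on_continuous[OF J(1) H] .
  have mono: "mono_on J h" using h by (rule subgradient_mono_on)
  fix a b assume ab: "a \<in> J" "b \<in> J" "a \<le> b"
  have sub: "{a..b} \<subseteq> J" using atLeastAtMost_subset_convex[OF J(2) ab(1,2)] .
  have mono': "mono_on {x..y} h" if "a \<le> x" "y \<le> b" for x y
    using that sub by (intro mono_on_subset[OF mono]) auto
  show int: "set_integrable lborel {a..b} h" by (intro set_integrable_mono_on mono') auto
  define D where "D x = integral {a..x} h - H x" for x
  have "D b = D a"
  proof (rule constant_of_mono_bound[OF _ ab(3)])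
    fix x y assume xy: "a \<le> x" "x \<le> y" "y \<le> b"
    have intg: "h integrable_on {u..w}" if "a \<le> u" "w \<le> b" for u w
      using integrable_on_mono_on[OF mono'[OF that]] .
    have eq: "integral {a..y} h - integral {a..x} h = integral {x..y} h"
      using Henstock_Kurzweil_Integration.integral_combine[OF xy(1,2) intg] xy by simp
    have xyJ: "x \<in> J" "y \<in> J" using xy sub by auto
    have "integral {x..y} (\<lambda>_. h x) \<le> integral {x..y} h" "integral {x..y} h \<le> integral {x..y} (\<lambda>_. h y)"
      using mono_onD[OF mono'[OF xy(1,3)]]
      by (intro integral_le intg[OF xy(1,3)] integrable_const_ivl; simp)+
    moreover have "h x * (y - x) \<le> H y - H x" "H y - H x \<le> h y * (y - x)"
      using h[OF xyJ] h[OF xyJ(2,1)] by (simp_all add: algebra_simps)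
    ultimately show "\<bar>D y - D x\<bar> \<le> (y - x) * (h y - h x)"
      using eq xy by (simp add: D_def algebra_simps abs_le_iff)
  qed
  then show "(LINT t:{a..b}|lborel. h t) = H b - H a"
    using set_borel_integral_eq_integral(2)[OF int] by (simp add: D_def)
qed

text \<open>On \<open>{a..b}\<close> the slopes lie between \<open>h a\<close> and
  \<open>h b\<close>, so \<open>H\<close> is Lipschitz there, with a constant \<open>L\<close> that
  is made positive to allow the choice \<open>\<epsilon> / L\<close> for
  \<open>\<delta>\<close>.\<close>

lemma subgradient_imp_locally_absolutely_continuous:
  fixes H h :: "real \<Rightarrow> real"
  assumes J: "convex J" and h: "\<And>x y. x \<in> J \<Longrightarrow> y \<in> J \<Longrightarrow> H x + h x * (y - x) \<le> H y"
  shows "locally_absolutely_continuous_on H J"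
  unfolding locally_absolutely_continuous_on_def
proof (intro allI impI)
  fix a b :: real assume sub: "{a..b} \<subseteq> J"
  have mono: "mono_on J h" using h by (rule subgradient_mono_on)
  define L where "L = \<bar>h a\<bar> + \<bar>h b\<bar> + 1"
  have L: "0 < L" by (simp add: L_def)
  have lip: "\<bar>H y - H x\<bar> \<le> L * (y - x)" if xy: "a \<le> x" "x \<le> y" "y \<le> b" for x y
  proof -
    have J': "a \<in> J" "b \<in> J" "x \<in> J" "y \<in> J" using sub xy by auto
    have "h a \<le> h x" "h y \<le> h b" using mono_onD[OF mono] J' xy by auto
    then have "(- L) * (y - x) \<le> h x * (y - x)" "h y * (y - x) \<le> L * (y - x)"
      using xy by (intro mult_right_mono; simp add: L_def)+
    then show ?thesis
      using h[OF J'(3,4)] h[OF J'(4,3)] by (simp add: algebra_simps abs_le_iff)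
  qed
  show "absolutely_continuous_on H {a..b}"
    unfolding absolutely_continuous_on_def
  proof (intro allI impI, rule exI, intro conjI allI impI)
    fix \<epsilon> :: real assume "0 < \<epsilon>"
    then show "0 < \<epsilon> / L" using L by simp
    fix m and u w :: "nat \<Rightarrow> real"
    assume "(\<forall>i<m. u i \<le> w i \<and> {u i..w i} \<subseteq> {a..b}) \<and>
      disjoint_family_on (\<lambda>i. {u i<..<w i}) {..<m} \<and> (\<Sum>i<m. w i - u i) < \<epsilon> / L"
    then have uw: "\<forall>i<m. u i \<le> w i \<and> {u i..w i} \<subseteq> {a..b}" and sum: "(\<Sum>i<m. w i - u i) < \<epsilon> / L"
      by auto
    have "(\<Sum>i<m. \<bar>H (w i) - H (u i)\<bar>) \<le> (\<Sum>i<m. L * (w i - u i))"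
      using uw by (intro sum_mono lip) auto
    also have "\<dots> = L * (\<Sum>i<m. w i - u i)" by (simp add: sum_distrib_left)
    also have "\<dots> < \<epsilon>" using sum L by (simp add: less_divide_eq mult.commute)
    finally show "(\<Sum>i<m. \<bar>H (w i) - H (u i)\<bar>) < \<epsilon>" .
  qed
qed

lemma mono_on_imp_locally_bounded_variation:
  assumes "mono_on J h"
  shows "locally_bounded_variation_on h J"
  unfolding locally_bounded_variation_on_def bounded_variation_on_def
proof (intro allI impI exI[of _ "h _ - h _"], elim conjE)
  fix a b :: real and m :: nat and x :: "nat \<Rightarrow> real"
  assume sub: "{a..b} \<subseteq> J" and x: "\<forall>i\<le>m. x i \<in> {a..b}" and inc: "\<forall>i<m. x i \<le> x (Suc i)"
  have mono: "h s \<le> h t" if "s \<in> {a..b}" "t \<in> {a..b}" "s \<le> t" for s t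
    using mono_onD[OF assms] that sub by blast
  have "(\<Sum>i<m. \<bar>h (x (Suc i)) - h (x i)\<bar>) = (\<Sum>i<m. h (x (Suc i)) - h (x i))"
    using x inc mono by (intro sum.cong) auto
  also have "\<dots> = h (x m) - h (x 0)" by (rule sum_lessThan_telescope)
  also have "\<dots> \<le> h b - h a"
    using x[rule_format, of m] x[rule_format, of 0] mono[of "x m" b] mono[of a "x 0"] by auto
  finally show "(\<Sum>i<m. \<bar>h (x (Suc i)) - h (x i)\<bar>) \<le> h b - h a" .
qed

lemma locally_integrable_onI:
  assumes J: "open J" "convex J" "J \<noteq> {}"
    and h: "\<And>a b. a \<in> J \<Longrightarrow> b \<in> J \<Longrightarrow> a < b \<Longrightarrow> set_integrable lborel {a..b} h"
  shows "locally_integrable_on h J"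
  unfolding locally_integrable_on_def
proof (intro allI impI, elim conjE)
  fix K :: "real set" assume K: "compact K" "K \<subseteq> J"
  obtain a b where ab: "a \<in> J" "b \<in> J" "a < b" "K \<subseteq> {a<..<b}"
    using compact_subset_greaterThanLessThan[OF J(1,3) K] by metis
  have "set_integrable lebesgue {a..b} h"
    using h[OF ab(1-3)] unfolding set_integrable_def
    by (subst integrable_completion) auto
  moreover have "K \<in> sets lebesgue" using K(1) by (simp add: lmeasurable_compact fmeasurableD)
  moreover have "K \<subseteq> {a..b}" using ab(4) by auto
  ultimately show "h absolutely_integrable_on K" by (rule set_integrable_subset)
qed

section \<open>The measure generated by a monotone function\<close>

text \<open>\<open>J\<close> is exhausted by compact sets \<open>C n\<close> of finite measure.
  Continuity from below reduces \<open>B\<close> to \<open>B \<inter> C n\<close>, where inner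
  regularity of finite Borel measures on the line is available.\<close>

lemma inner_regular_sigma_compact:
  fixes \<mu> :: "real measure"
  assumes J: "open J" and sets: "sets \<mu> = sets (restrict_space borel J)"
    and fin: "\<And>K. compact K \<Longrightarrow> K \<subseteq> J \<Longrightarrow> emeasure \<mu> K < \<infinity>" and B: "B \<in> sets \<mu>"
  shows "emeasure \<mu> B = (SUP K \<in> {K. compact K \<and> K \<subseteq> B}. emeasure \<mu> K)"
proof (rule antisym)
  have setsI: "A \<in> sets \<mu>" if "A \<in> sets borel" "A \<subseteq> J" for A
    using that J unfolding sets by (simp add: sets_restrict_space_iff)
  have BJ: "B \<in> sets borel" "B \<subseteq> J"
    using B J unfolding sets by (simp_all add: sets_restrict_space_iff)
  obtain C :: "nat \<Rightarrow> real set" where C: "\<And>n. compact (C n)" "\<And>n. C n \<subseteq> J"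
    "\<And>n. C n \<subseteq> interior (C (Suc n))" "\<Union> (range C) = J"
    using open_Union_compact_subsets[OF J] by metis
  have Cb: "C n \<in> sets borel" for n using C(1) by (simp add: borel_compact)
  have space: "space \<mu> = J" using sets_eq_imp_space_eq[OF sets] by (simp add: space_restrict_space)
  have inc: "incseq (\<lambda>n. B \<inter> C n)"
    using C(3) interior_subset by (intro incseq_SucI) blast
  have BC: "B \<inter> C n \<in> sets \<mu>" for n using BJ Cb[of n] by (intro setsI) auto
  have "emeasure \<mu> B = emeasure \<mu> (\<Union>n. B \<inter> C n)"
    using C(4) BJ by (intro arg_cong[of _ _ "emeasure \<mu>"]) auto
  also have "\<dots> = (SUP n. emeasure \<mu> (B \<inter> C n))"
    using BC inc by (intro SUP_emeasure_incseq[symmetric]) auto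
  also have "\<dots> \<le> (SUP K \<in> {K. compact K \<and> K \<subseteq> B}. emeasure \<mu> K)"
  proof (rule SUP_least)
    fix n
    \<comment> \<open>The finite measure sending \<open>A\<close> to
      \<open>emeasure \<mu> (A \<inter> C n)\<close>, now on the Borel sets of the whole
      line.\<close>
    define \<nu> where "\<nu> = distr (restrict_space \<mu> (C n)) borel (\<lambda>x. x)"
    have Cn: "C n \<in> sets \<mu>" using Cb C(2) by (rule setsI)
    have meas: "(\<lambda>x. x) \<in> measurable (restrict_space \<mu> (C n)) borel"
    proof (rule measurableI)
      fix A :: "real set" assume A: "A \<in> sets borel"
      have "A \<inter> C n \<in> sets \<mu>" using A Cb[of n] C(2)[of n] by (intro setsI) auto
      then show "(\<lambda>x. x) -` A \<inter> space (restrict_space \<mu> (C n)) \<in> sets (restrict_space \<mu> (C n))"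
        using Cn C(2)[of n] space
        by (auto simp: sets_restrict_space_iff space_restrict_space Int_absorb1 Int_commute intro!: sets.Int)
    qed simp
    have em: "emeasure \<nu> A = emeasure \<mu> (A \<inter> C n)" if A: "A \<in> sets borel" for A
    proof -
      have "emeasure \<nu> A = emeasure (restrict_space \<mu> (C n)) (A \<inter> C n)"
        unfolding \<nu>_def using C(2)[of n] space
        by (subst emeasure_distr[OF meas A]) (simp add: space_restrict_space Int_absorb2)
      also have "\<dots> = emeasure \<mu> (A \<inter> C n)"
        using Cn by (intro emeasure_restrict_space) auto
      finally show ?thesis .
    qed
    have "emeasure \<nu> (space \<nu>) \<noteq> \<infinity>"
      using fin[OF C(1,2), of n] em[of UNIV] by (simp add: \<nu>_def)
    then have "emeasure \<nu> (B \<inter> C n) = (SUP K \<in> {K. K \<subseteq> B \<inter> C n \<and> compact K}. emeasure \<nu> K)"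
      using BJ Cb[of n] by (intro inner_regular) (auto simp: \<nu>_def)
    also have "\<dots> \<le> (SUP K \<in> {K. compact K \<and> K \<subseteq> B}. emeasure \<mu> K)"
    proof (rule SUP_mono)
      fix K assume K: "K \<in> {K. K \<subseteq> B \<inter> C n \<and> compact K}"
      then have "emeasure \<nu> K = emeasure \<mu> K"
        using em[of K] by (simp add: borel_compact Int_absorb2)
      then show "\<exists>K'\<in>{K. compact K \<and> K \<subseteq> B}. emeasure \<nu> K \<le> emeasure \<mu> K'"
        using K by (intro bexI[of _ K]) auto
    qed
    finally show "emeasure \<mu> (B \<inter> C n) \<le> (SUP K \<in> {K. compact K \<and> K \<subseteq> B}. emeasure \<mu> K)"
      using em[of "B \<inter> C n"] BJ Cb[of n] by (simp add: Int_assoc)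
  qed
  finally show "emeasure \<mu> B \<le> (SUP K \<in> {K. compact K \<and> K \<subseteq> B}. emeasure \<mu> K)" .
next
  show "(SUP K \<in> {K. compact K \<and> K \<subseteq> B}. emeasure \<mu> K) \<le> emeasure \<mu> B"
    using B by (intro SUP_least) (auto intro: emeasure_mono)
qed

text \<open>The measure is the image of Lebesgue measure under the generalized inverse \<open>q\<close> of \<open>h\<close>;
  unlike a Stieltjes measure it needs no extension of \<open>h\<close>, which may be unbounded on \<open>J\<close>,
  to the whole line.\<close>

lemma distr_deriv_mono_radon_measure:
  fixes h :: "real \<Rightarrow> real"
  assumes J: "open J" "convex J" "J \<noteq> {}" and mono: "mono_on J h"
    and right: "\<And>x y. x \<in> J \<Longrightarrow> h x < y \<Longrightarrow> \<exists>t\<in>J. x < t \<and> h t < y"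
  obtains \<mu> where "radon_measure_on J \<mu>"
    "distr_eq J (distr_deriv (distr_of_fun J h)) (distr_of_measure \<mu>)"
proof -
  \<comment> \<open>The levels at which the infimum defining \<open>q\<close> is taken over a
    nonempty set that is bounded below by a point of \<open>J\<close>; there \<open>q\<close> has
    its values in \<open>J\<close>.\<close>
  define D where "D = {y. (\<exists>s\<in>J. h s < y) \<and> (\<exists>t\<in>J. y \<le> h t)}"
  define q where "q y = Inf {t \<in> J. y \<le> h t}" for y
  have "is_interval D"
    unfolding is_interval_1 D_def by (auto intro: order.strict_trans2 order_trans)
  then have D: "D \<in> sets borel" by (rule real_interval_borel_measurable)
  have bdd: "bdd_below {t \<in> J. y \<le> h t}" and ne: "{t \<in> J. y \<le> h t} \<noteq> {}" if y: "y \<in> D" for y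
  proof -
    obtain s where s: "s \<in> J" "h s < y" using y unfolding D_def by blast
    show "bdd_below {t \<in> J. y \<le> h t}"
    proof (rule bdd_belowI)
      fix t assume "t \<in> {t \<in> J. y \<le> h t}"
      then show "s \<le> t" using mono_onD[OF mono, of t s] s by force
    qed
    show "{t \<in> J. y \<le> h t} \<noteq> {}" using y unfolding D_def by blast
  qed
  have qJ: "q y \<in> J" if y: "y \<in> D" for y
  proof -
    obtain s t where st: "s \<in> J" "h s < y" "t \<in> J" "y \<le> h t" using y unfolding D_def by blast
    have "s \<le> q y" unfolding q_def
    proof (rule cInf_greatest[OF ne[OF y]])
      fix t assume "t \<in> {t \<in> J. y \<le> h t}"
      then show "s \<le> t" using mono_onD[OF mono, of t s] st by force
    qed
    moreover have "q y \<le> t" unfolding q_def using st by (intro cInf_lower bdd[OF y]) auto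
    ultimately show ?thesis using atLeastAtMost_subset_convex[OF J(2) st(1,3)] by auto
  qed
  \<comment> \<open>The Galois connection between \<open>q\<close> and \<open>h\<close>. Right
    continuity yields the implication from left to right: if \<open>h t < y\<close>, then
    \<open>h\<close> is still below \<open>y\<close> at some \<open>u\<close> beyond
    \<open>t\<close>, which forces \<open>u \<le> q y\<close>.\<close>
  have q_le_iff: "q y \<le> t \<longleftrightarrow> y \<le> h t" if y: "y \<in> D" and t: "t \<in> J" for y t
  proof
    assume "y \<le> h t"
    then show "q y \<le> t" unfolding q_def using t by (intro cInf_lower bdd[OF y]) auto
  next
    assume le: "q y \<le> t"
    show "y \<le> h t"
    proof (rule ccontr)
      assume "\<not> y \<le> h t"
      then obtain u where u: "u \<in> J" "t < u" "h u < y" using right[OF t, of y] by auto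
      have "u \<le> q y" unfolding q_def
      proof (rule cInf_greatest[OF ne[OF y]])
        fix s assume "s \<in> {t \<in> J. y \<le> h t}"
        then show "u \<le> s" using mono_onD[OF mono, of s u] u by force
      qed
      then show False using le u by simp
    qed
  qed
  have "mono_on D q"
  proof (rule mono_onI)
    fix x y assume xy: "x \<in> D" "y \<in> D" "x \<le> y"
    have "y \<le> h (q y)" using q_le_iff[OF xy(2) qJ[OF xy(2)]] by simp
    then show "q x \<le> q y" using q_le_iff[OF xy(1) qJ[OF xy(2)]] xy(3) by simp
  qed
  then have qm: "q \<in> borel_measurable (restrict_space borel D)" by (rule borel_measurable_mono_on_fnc)
  \<comment> \<open>Extension by 0 outside \<open>D\<close>, to have a Borel function on the whole
    line for the Fubini argument.\<close>
  define q0 where "q0 y = indicator D y *\<^sub>R q y" for y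
  have q0: "q0 \<in> borel_measurable borel"
    using qm D unfolding q0_def[abs_def] by (simp add: borel_measurable_restrict_space_iff)
  define M where "M = restrict_space lborel D"
  have spM: "space M = D" by (simp add: M_def space_restrict_space)
  have qM: "q \<in> measurable M (restrict_space borel J)"
  proof (rule measurable_restrict_space2)
    show "q \<in> space M \<rightarrow> J" using qJ spM by auto
    have "sets M = sets (restrict_space borel D)"
      unfolding M_def by (rule sets_restrict_space_cong) simp
    then show "q \<in> borel_measurable M" using qm by (simp cong: measurable_cong_sets)
  qed
  define \<mu> where "\<mu> = distr M (restrict_space borel J) q"
  have sets\<mu>: "sets \<mu> = sets (restrict_space borel J)" by (simp add: \<mu>_def)
  have fin: "emeasure \<mu> K < \<infinity>" if K: "compact K" "K \<subseteq> J" for K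
  proof -
    obtain a b where ab: "a \<in> J" "b \<in> J" "a < b" "K \<subseteq> {a<..<b}"
      using compact_subset_greaterThanLessThan[OF J(1,3) K] by metis
    have Ks: "K \<in> sets (restrict_space borel J)"
      using K J(1) by (simp add: sets_restrict_space_iff borel_compact)
    \<comment> \<open>By the Galois connection, levels sent into \<open>{a<..<b}\<close> lie between
      \<open>h a\<close> and \<open>h b\<close>; hence \<open>K\<close> has finite measure.\<close>
    have "q -` K \<inter> D \<subseteq> {h a..h b}"
    proof
      fix y assume y: "y \<in> q -` K \<inter> D"
      then have "a < q y" "q y < b" using ab(4) by auto
      then show "y \<in> {h a..h b}"
        using q_le_iff[of y a] q_le_iff[of y b] y ab by auto
    qed
    moreover have "emeasure \<mu> K = emeasure lborel (q -` K \<inter> D)"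
      using emeasure_distr[OF qM Ks] spM D unfolding \<mu>_def M_def
      by (subst (asm) emeasure_restrict_space) auto
    ultimately have "emeasure \<mu> K \<le> emeasure lborel {h a..h b}"
      by (auto intro: emeasure_mono)
    also have "\<dots> < \<infinity>" by (simp add: emeasure_lborel_Icc_eq)
    finally show ?thesis .
  qed
  have "radon_measure_on J \<mu>"
    unfolding radon_measure_on_def
    using sets\<mu> fin inner_regular_sigma_compact[OF J(1) sets\<mu> fin] by blast
  moreover have "distr_eq J (distr_deriv (distr_of_fun J h)) (distr_of_measure \<mu>)"
    unfolding distr_eq_def distr_deriv_def distr_of_measure_def
  proof (intro allI impI)
    fix \<phi> assume \<phi>: "test_function J \<phi>"
    note \<phi>' = test_function_deriv[OF \<phi>]
    obtain a b where ab: "a \<in> J" "b \<in> J" "a < b" and zero: "\<And>t. t \<notin> {a<..<b} \<Longrightarrow> \<phi> t = 0"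
      "\<And>t. t \<notin> {a<..<b} \<Longrightarrow> deriv \<phi> t = 0"
      using test_function_interval[OF J(1,3) \<phi>] by metis
    have sub: "{a..b} \<subseteq> J" using atLeastAtMost_subset_convex[OF J(2) ab(1,2)] .
    have cont: "continuous_on UNIV \<phi>" "continuous_on UNIV (deriv \<phi>)"
      using test_function_has_deriv[OF \<phi>] test_function_has_deriv[OF \<phi>']
      by (auto intro: has_real_derivative_imp_continuous_on)
    have [measurable]: "\<phi> \<in> borel_measurable borel"
      using cont(1) by (rule borel_measurable_continuous_onI)
    have inth: "set_integrable lborel {a..b} h"
      by (intro set_integrable_mono_on mono_on_subset[OF mono sub])
    \<comment> \<open>By the Galois connection this interval consists of the levels that
      \<open>q\<close> sends into \<open>{a<..b}\<close>. Outside it \<open>\<phi> (q y)\<close>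
      vanishes, and its part with \<open>q y \<le> t\<close> is \<open>{h a<..h t}\<close>, of
      length \<open>h t - h a\<close>.\<close>
    define W :: "real \<Rightarrow> real" where "W y = indicator {h a<..h b} y" for y
    have W: "integrable lborel W" 
      unfolding W_def[abs_def] using mono_onD[OF mono ab(1,2)] ab(3) by simp
    have WD: "y \<in> D" if "W y \<noteq> 0" for y
      using that ab unfolding W_def D_def by (auto simp: indicator_def split: if_splits)
    have inner: "(\<integral>y. W y * (if q0 y \<le> t then 1 else 0) \<partial>lborel) = h t - h a" if t: "t \<in> {a..b}" for t
    proof -
      have tJ: "t \<in> J" and ht: "h a \<le> h t" "h t \<le> h b"
        using t sub ab mono_onD[OF mono] by auto
      have "W y * (if q0 y \<le> t then 1 else 0) = indicator {h a<..h t} y" for y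
        using WD[of y] q_le_iff[of y t] tJ ht by (auto simp: W_def q0_def indicator_def)
      then show ?thesis using ht by simp
    qed
    have "(\<integral>t. \<phi> t \<partial>\<mu>) = (\<integral>y. \<phi> (q y) \<partial>M)"
      unfolding \<mu>_def by (rule integral_distr[OF qM measurable_restrict_space1]) simp
    also have "\<dots> = (\<integral>y. indicator D y *\<^sub>R \<phi> (q y) \<partial>lborel)"
      unfolding M_def using D by (intro integral_restrict_space) simp
    also have "\<dots> = (\<integral>y. W y * \<phi> (q0 y) \<partial>lborel)"
    proof (rule Bochner_Integration.integral_cong[OF refl])
      fix y
      have "\<phi> (q y) = 0" if "y \<in> D" "W y = 0"
      proof -
        have "y \<le> h a \<or> \<not> y \<le> h b" using that(2) by (auto simp: W_def indicator_def split: if_splits)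
        then have "q y \<notin> {a<..<b}" using q_le_iff[OF that(1) ab(1)] q_le_iff[OF that(1) ab(2)] by auto
        then show ?thesis by (rule zero(1))
      qed
      then show "indicator D y *\<^sub>R \<phi> (q y) = W y * \<phi> (q0 y)"
        using WD[of y] by (auto simp: W_def q0_def indicator_def)
    qed
    also have "\<dots> = - (\<integral>t. indicator {a..b} t * deriv \<phi> t * (\<integral>y. W y * (if q0 y \<le> t then 1 else 0) \<partial>lborel) \<partial>lborel)"
    proof (rule integral_comp_eq_integral_deriv[OF W q0 test_function_has_deriv[OF \<phi>] cont(2)])
      show "\<phi> b = 0" by (rule zero(1)) simp
      fix y assume y: "W y \<noteq> 0"
      then have "h a < y" "y \<le> h b" by (auto simp: W_def indicator_def split: if_splits)
      then show "q0 y \<in> {a..b}"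
        using WD[OF y] q_le_iff[OF WD[OF y], of a] q_le_iff[OF WD[OF y], of b] ab by (simp add: q0_def)
    qed
    also have "(\<integral>t. indicator {a..b} t * deriv \<phi> t * (\<integral>y. W y * (if q0 y \<le> t then 1 else 0) \<partial>lborel) \<partial>lborel) =
        (\<integral>t. indicator {a..b} t * h t * deriv \<phi> t - indicator {a..b} t * deriv \<phi> t * h a \<partial>lborel)"
    proof (rule Bochner_Integration.integral_cong[OF refl])
      fix t
      show "indicator {a..b} t * deriv \<phi> t * (\<integral>y. W y * (if q0 y \<le> t then 1 else 0) \<partial>lborel) =
          indicator {a..b} t * h t * deriv \<phi> t - indicator {a..b} t * deriv \<phi> t * h a"
        by (cases "t \<in> {a..b}") (simp_all add: inner right_diff_distrib)
    qed
    also have "\<dots> = (\<integral>t. indicator {a..b} t * h t * deriv \<phi> t \<partial>lborel)"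
    proof -
      have int1: "integrable lborel (\<lambda>t. indicator {a..b} t * h t * deriv \<phi> t)"
      proof -
        obtain B where B: "\<And>t. t \<in> {a..b} \<Longrightarrow> \<bar>deriv \<phi> t\<bar> \<le> B"
          using compact_imp_bounded[OF compact_continuous_image[OF continuous_on_subset[OF cont(2) subset_UNIV] compact_Icc]]
          unfolding bounded_iff by (metis imageI real_norm_def)
        have [measurable]: "deriv \<phi> \<in> borel_measurable borel"
          using cont(2) by (rule borel_measurable_continuous_onI)
        have ih: "integrable lborel (\<lambda>t. indicator {a..b} t * h t)"
          using inth unfolding set_integrable_def by simp
        then have [measurable]: "(\<lambda>t. indicator {a..b} t * h t) \<in> borel_measurable borel" by auto
        have "integrable lborel (\<lambda>t. B * (indicator {a..b} t * h t))" using ih by simp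
        then show ?thesis
        proof (rule Bochner_Integration.integrable_bound)
          show "AE t in lborel. norm (indicator {a..b} t * h t * deriv \<phi> t) \<le> norm (B * (indicator {a..b} t * h t))"
          proof (rule AE_I2)
            fix t
            show "norm (indicator {a..b} t * h t * deriv \<phi> t) \<le> norm (B * (indicator {a..b} t * h t))"
            proof (cases "t \<in> {a..b}")
              case True
              have "\<bar>h t\<bar> * \<bar>deriv \<phi> t\<bar> \<le> \<bar>h t\<bar> * \<bar>B\<bar>"
                using B[OF True] by (intro mult_left_mono) auto
              then show ?thesis using True by (simp add: abs_mult mult.commute)
            qed simp
          qed
        qed measurable
      qed
      have int2: "integrable lborel (\<lambda>t. indicator {a..b} t * deriv \<phi> t * h a)"
        using borel_integrable_atLeastAtMost'[of a b "\<lambda>t. deriv \<phi> t * h a"]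
          continuous_on_subset[OF cont(2) subset_UNIV]
        unfolding set_integrable_def by (simp add: continuous_on_mult mult.assoc)
      have "(\<integral>t. indicator {a..b} t * deriv \<phi> t * h a \<partial>lborel) = 0"
        using integral_FTC_Icc_real[of a b \<phi> "deriv \<phi>"] ab test_function_has_deriv[OF \<phi>] cont(2)
          zero(1)[of a] zero(1)[of b]
        by (simp add: continuous_on_eq_continuous_at mult.commute)
      then show ?thesis using int1 int2 by simp
    qed
    also have "\<dots> = distr_of_fun J h (deriv \<phi>)"
      using inth zero(2)
      by (intro distr_of_fun_eq_integral[OF sub _ cont(2), symmetric])
        (auto simp: set_integrable_def set_borel_measurable_def)
    finally show "- distr_of_fun J h (deriv \<phi>) = (\<integral>t. \<phi> t \<partial>\<mu>)" by simp
  qed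
  ultimately show ?thesis using that by blast
qed

section \<open>Positive semidefinite matrices\<close>

lemma quadratic_form_sum:
  fixes A :: "real^'n^'n"
  shows "x \<bullet> (A *v x) = (\<Sum>i\<in>UNIV. \<Sum>j\<in>UNIV. x $ i * x $ j * A $ i $ j)"
  by (simp add: inner_vec_def matrix_vector_mult_def sum_distrib_left ac_simps)

text \<open>The quadratic form at the difference of two basis vectors. It yields both the
  monotonicity of \<open>f\<close> and the midpoint convexity of \<open>g\<close>.\<close>

lemma psd_matrix_two_entries:
  fixes A :: "real^'n^'n"
  assumes "psd_matrix A"
  shows "0 \<le> A $ i $ i - A $ i $ j - A $ j $ i + A $ j $ j"
proof -
  have "0 \<le> (axis i 1 - axis j 1) \<bullet> (A *v (axis i 1 - axis j 1))"
    using assms unfolding psd_matrix_def by blast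
  then show ?thesis
    by (simp add: matrix_vector_mult_diff_distrib matrix_vector_mult_basis inner_diff_left
        inner_diff_right inner_axis' column_def)
qed

lemma psd_matrix_exp_rank_one:
  fixes s :: "'n::finite \<Rightarrow> real"
  shows "psd_matrix (\<chi> i j. exp (s i + s j) :: real^'n^'n)"
  unfolding psd_matrix_def
proof (intro conjI allI)
  show "transpose (\<chi> i j. exp (s i + s j)) = (\<chi> i j. exp (s i + s j) :: real^'n^'n)"
    by (simp add: transpose_def add.commute)
  fix x :: "real^'n"
  have "x \<bullet> ((\<chi> i j. exp (s i + s j)) *v x) = (\<Sum>i\<in>UNIV. x $ i * exp (s i))\<^sup>2"
    by (simp add: quadratic_form_sum exp_add power2_eq_square sum_product ac_simps)
  then show "0 \<le> x \<bullet> ((\<chi> i j. exp (s i + s j)) *v x)" by simp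
qed

lemma psd_matrix_constant_plus_diagonal:
  assumes "0 \<le> a" "a \<le> b"
  shows "psd_matrix (\<chi> i j. if i = j then b else a :: real^'n^'n)"
  unfolding psd_matrix_def
proof (intro conjI allI)
  show "transpose (\<chi> i j. if i = j then b else a) = (\<chi> i j. if i = j then b else a :: real^'n^'n)"
    by (simp add: transpose_def eq_commute)
  fix x :: "real^'n"
  have "x $ i * x $ j * (if i = j then b else a) = a * (x $ i * x $ j) + (if i = j then (b - a) * (x $ i * x $ j) else 0)"
    for i j by (simp add: algebra_simps)
  \<comment> \<open>The matrix splits into \<open>a\<close> times the all-ones matrix and
    \<open>b - a\<close> times the identity.\<close>
  then have "x \<bullet> ((\<chi> i j. if i = j then b else a) *v x) =
      a * (\<Sum>i\<in>UNIV. x $ i)\<^sup>2 + (b - a) * (\<Sum>i\<in>UNIV. x $ i * x $ i)"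
    by (simp add: quadratic_form_sum sum.distrib power2_eq_square sum_product flip: sum_distrib_left)
  also have "0 \<le> \<dots>"
    using assms by (intro add_nonneg_nonneg mult_nonneg_nonneg[of a] mult_nonneg_nonneg[of "b - a"] sum_nonneg) auto
  finally show "0 \<le> x \<bullet> ((\<chi> i j. if i = j then b else a) *v x)" .
qed

text \<open>For nodes in arithmetic progression the matrix is of Hankel type. Its quadratic form at
  the coefficients of the difference of order \<open>p = CARD('n) - 1\<close> is that difference
  applied twice to \<open>g\<close>, hence a difference of order \<open>2 * p\<close>.\<close>

lemma hankel_psd_imp_diff_nonneg:
  fixes g :: "real \<Rightarrow> real"
  assumes J: "convex J"
    and psd: "\<And>s :: 'n::finite \<Rightarrow> real. (\<And>i j. s i + s j \<in> J) \<Longrightarrow> psd_matrix (\<chi> i j. g (s i + s j) :: real^'n^'n)"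
  shows "diff_nonneg (2 * (CARD('n) - 1)) g J"
  unfolding diff_nonneg_def
proof (intro allI impI, elim conjE)
  fix t h :: real
  define p where "p = CARD('n) - 1"
  assume h: "0 < h" and t: "t \<in> J" "t + real (2 * (CARD('n) - 1)) * h \<in> J"
  have sub: "{t..t + real (2 * p) * h} \<subseteq> J"
    unfolding p_def using atLeastAtMost_subset_convex[OF J t] .
  \<comment> \<open>The index type carries no order, so \<open>\<iota>\<close> numbers its elements
    by \<open>0\<close> to \<open>p\<close>.\<close>
  obtain \<iota> where "bij_betw \<iota> (UNIV :: 'n set) {0..<CARD('n)}"
    using ex_bij_betw_finite_nat[OF finite] by blast
  moreover have "CARD('n) = Suc p" unfolding p_def by simp
  then have "{0..<CARD('n)} = {..p}" by (simp only: atLeast0LessThan lessThan_Suc_atMost)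
  ultimately have \<iota>: "bij_betw \<iota> (UNIV :: 'n set) {..p}" by simp
  have \<iota>le: "\<iota> i \<le> p" for i using bij_betwE[OF \<iota>] by auto
  obtain c :: "nat \<Rightarrow> real" where
    c: "\<And>g h x. (fwd_diff h ^^ p) g x = (\<Sum>i\<le>p. c i * g (x + of_nat i * h))"
    using fwd_diff_expansion[of p] by blast
  define s where "s i = t / 2 + real (\<iota> i) * h" for i
  have ss: "s i + s j = t + real (\<iota> i) * h + real (\<iota> j) * h" for i j by (simp add: s_def)
  have "s i + s j \<in> J" for i j
  proof (rule subsetD[OF sub])
    have "real (\<iota> i) + real (\<iota> j) \<le> real (2 * p)" using \<iota>le[of i] \<iota>le[of j] by simp
    then have "(real (\<iota> i) + real (\<iota> j)) * h \<le> real (2 * p) * h" using h by (intro mult_right_mono) auto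
    then show "s i + s j \<in> {t..t + real (2 * p) * h}"
      using h by (simp add: ss distrib_right)
  qed
  then have "0 \<le> (\<chi> i. c (\<iota> i)) \<bullet> ((\<chi> i j. g (s i + s j)) *v (\<chi> i. c (\<iota> i)))"
    using psd[of s] unfolding psd_matrix_def by blast
  also have "\<dots> = (\<Sum>i\<in>UNIV. \<Sum>j\<in>UNIV. c (\<iota> i) * c (\<iota> j) * g (t + real (\<iota> i) * h + real (\<iota> j) * h))"
    by (simp add: quadratic_form_sum ss)
  also have "\<dots> = (\<Sum>i\<le>p. \<Sum>j\<le>p. c i * c j * g (t + real i * h + real j * h))"
  proof -
    have "(\<Sum>j\<in>UNIV. c k * c (\<iota> j) * g (t + real k * h + real (\<iota> j) * h)) =
        (\<Sum>j\<le>p. c k * c j * g (t + real k * h + real j * h))" for k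
      by (rule sum.reindex_bij_betw[OF \<iota>])
    then show ?thesis
      using sum.reindex_bij_betw[OF \<iota>, of "\<lambda>i. \<Sum>j\<le>p. c i * c j * g (t + real i * h + real j * h)"]
      by simp
  qed
  also have "\<dots> = (fwd_diff h ^^ p) ((fwd_diff h ^^ p) g) t"
    by (simp add: c sum_distrib_left mult.assoc)
  also have "\<dots> = (fwd_diff h ^^ (2 * (CARD('n) - 1))) g t"
    unfolding p_def[symmetric] by (simp add: mult_2 funpow_add)
  finally show "0 \<le> (fwd_diff h ^^ (2 * (CARD('n) - 1))) g t" .
qed

text \<open>A monotone function is bounded on compact intervals, so the local bound for differences
  applies with \<open>m = 1\<close> and makes \<open>g\<close> locally Lipschitz.\<close>

lemma mono_on_diff_nonneg_2_continuous:
  assumes J: "open J" "convex J" and mono: "mono_on J g" and diff: "diff_nonneg 2 g J"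
  shows "continuous_on J g"
proof (rule continuous_at_imp_continuous_on, rule ballI)
  fix t assume "t \<in> J"
  then obtain R where R: "0 < R" "cball t R \<subseteq> J"
    using J(1) unfolding open_contains_cball by blast
  define r where "r = R / 3"
  have r: "0 < r" "{t - 3 * r..t + 3 * r} \<subseteq> J"
    using R by (auto simp: r_def cball_eq_atLeastAtMost)
  have "bounded (g ` {t - 3 * r..t + 3 * r})"
  proof (rule bounded_subset[OF bounded_closed_interval])
    show "g ` {t - 3 * r..t + 3 * r} \<subseteq> {g (t - 3 * r)..g (t + 3 * r)}"
      using r by (force intro!: mono_onD[OF mono])
  qed
  then obtain C where C: "0 < C"
    "\<And>x h. 0 < h \<Longrightarrow> t - r \<le> x \<Longrightarrow> x + of_nat 1 * h \<le> t + r \<Longrightarrow> \<bar>(fwd_diff h ^^ 1) g x\<bar> \<le> C * h ^ 1"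
    using fwd_diff_locally_bounded[OF J(2), of 1 g t r] diff r by (auto simp: numeral_2_eq_2)
  have lip: "\<bar>g y - g x\<bar> \<le> C * (y - x)" if "t - r \<le> x" "x < y" "y \<le> t + r" for x y
    using C(2)[of "y - x" x] that by (simp add: fwd_diff_def)
  have "\<bar>g y - g t\<bar> \<le> C * \<bar>y - t\<bar>" if "\<bar>y - t\<bar> < r" for y
    using lip[of t y] lip[of y t] that by (cases y t rule: linorder_cases) auto
  then have "\<forall>\<^sub>F y in at t. norm (g y - g t) \<le> C * \<bar>y - t\<bar>"
    using r(1) unfolding eventually_at by (intro exI[of _ r]) (auto simp: dist_real_def)
  moreover have "((\<lambda>y. C * \<bar>y - t\<bar>) \<longlongrightarrow> 0) (at t)"
    by (intro tendsto_eq_intros) auto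
  ultimately have "((\<lambda>y. g y - g t) \<longlongrightarrow> 0) (at t)" by (rule Lim_null_comparison)
  then show "isCont g t" unfolding isCont_def by (rule LIM_zero_cancel)
qed

section \<open>Iterated distributional derivatives\<close>

lemma distr_eq_deriv_cong: "distr_eq J S T \<Longrightarrow> distr_eq J (distr_deriv S) (distr_deriv T)"
  unfolding distr_eq_def distr_deriv_def using test_function_deriv by auto

lemma distr_eq_trans: "distr_eq J S T \<Longrightarrow> distr_eq J T U \<Longrightarrow> distr_eq J S U"
  unfolding distr_eq_def by simp

lemma distr_deriv_funpow_Ck:
  assumes J: "open J" "convex J" "J \<noteq> {}" and g: "Ck_on k g J"
  shows "distr_eq J ((distr_deriv ^^ k) (distr_of_fun J g)) (distr_of_fun J ((deriv ^^ k) g))"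
  using g
proof (induction k)
  case 0
  show ?case by (simp add: distr_eq_def)
next
  case (Suc k)
  have "antiderivative_on J ((deriv ^^ k) g) ((deriv ^^ Suc k) g)"
  proof (rule antiderivative_on_C1[OF J(1,2)])
    show "((deriv ^^ k) g has_real_derivative (deriv ^^ Suc k) g x) (at x)" if "x \<in> J" for x
      using Suc.prems that by (simp add: Ck_on_def DERIV_deriv_iff_field_differentiable)
    show "continuous_on J ((deriv ^^ Suc k) g)" using Suc.prems unfolding Ck_on_def by blast
  qed
  from distr_deriv_antiderivative[OF J this] distr_eq_deriv_cong[OF Suc.IH[OF Ck_on_Suc_imp[OF Suc.prems]]]
  show ?case using distr_eq_trans by simp
qed

theorem mainTheorem3:
  fixes f g :: "real \<Rightarrow> real" and \<rho> :: ereal and I J :: "real set"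
  assumes n: "CARD('n::finite) \<ge> 2"
    and \<rho>: "0 < \<rho>"
    and I: "I = {x. 0 < x \<and> ereal x < \<rho>}"
    and J: "J = {t. ereal t < ereal_ln \<rho>}"
    and f: "\<And>A :: real^'n^'n. A \<in> psd_matrices_in I \<Longrightarrow> psd_matrix (map_matrix f A)"
    and g: "\<And>t. t \<in> J \<Longrightarrow> g t = f (exp t)"
  shows "continuous_on I f
    \<and> locally_integrable_on g J
    \<and> (\<exists>\<mu>. radon_measure_on J \<mu> \<and>
          distr_eq J ((distr_deriv ^^ (2 * CARD('n) - 2)) (distr_of_fun J g)) (distr_of_measure \<mu>))
    \<and> (\<exists>h. locally_bounded_variation_on h J \<and>
          distr_represented_by J ((distr_deriv ^^ (2 * CARD('n) - 3)) (distr_of_fun J g)) h)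
    \<and> (\<exists>h. locally_absolutely_continuous_on h J \<and>
          distr_represented_by J ((distr_deriv ^^ (2 * CARD('n) - 4)) (distr_of_fun J g)) h)
    \<and> Ck_on (2 * CARD('n) - 4) f I"
proof -
  have IJ: "open I \<and> open J \<and> convex J \<and> J \<noteq> {} \<and> ln ` I \<subseteq> J \<and> exp ` J \<subseteq> I"
  proof (cases \<rho>)
    case (real r)
    then have r: "0 < r" using \<rho> by simp
    have "I = {0<..<r}" "J = {..<ln r}" using real r by (auto simp: I J ereal_ln_def)
    moreover have "exp t < r" if "t < ln r" for t using that r by (metis exp_less_cancel_iff exp_ln)
    moreover have "ln r - 1 \<in> {..<ln r}" by simp
    ultimately show ?thesis by (auto simp del: lessThan_iff)
  next
    case PInf
    then have "I = {0<..}" "J = UNIV" by (auto simp: I J ereal_ln_def)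
    then show ?thesis by auto
  qed (use \<rho> in simp)
  then have op: "open I" and Jop: "open J" "convex J" "J \<noteq> {}" and lnI: "ln ` I \<subseteq> J"
    and expJ: "\<And>t. t \<in> J \<Longrightarrow> exp t \<in> I" by auto
  have Ipos: "I \<subseteq> {0<..}" by (auto simp: I)
  obtain i0 j0 :: 'n where ij: "i0 \<noteq> j0"
    using n card_le_Suc0_iff_eq[of "UNIV :: 'n set"] by auto

  have psd: "psd_matrix (\<chi> i j. g (s i + s j) :: real^'n^'n)"
    if s: "\<And>i j. s i + s j \<in> J" for s :: "'n \<Rightarrow> real"
  proof -
    have "psd_matrix (map_matrix f (\<chi> i j. exp (s i + s j) :: real^'n^'n))"
      using expJ[OF s] psd_matrix_exp_rank_one by (intro f) (auto simp: psd_matrices_in_def)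
    moreover have "map_matrix f (\<chi> i j. exp (s i + s j) :: real^'n^'n) = (\<chi> i j. g (s i + s j))"
      by (simp add: map_matrix_def vec_eq_iff g[OF s])
    ultimately show ?thesis by simp
  qed
  have fmono: "f a \<le> f b" if ab: "a \<in> I" "b \<in> I" "a \<le> b" for a b
  proof -
    have "psd_matrix (map_matrix f (\<chi> i j. if i = j then b else a :: real^'n^'n))"
      using psd_matrix_constant_plus_diagonal[of a b] ab Ipos
      by (intro f) (auto simp: psd_matrices_in_def)
    \<comment> \<open>Here the quadratic form equals \<open>2 * (f b - f a)\<close>.\<close>
    from psd_matrix_two_entries[OF this, of i0 j0] show ?thesis
      using ij by (simp add: map_matrix_def)
  qed
  have gmono: "mono_on J g"
    by (rule mono_onI) (simp add: g expJ fmono)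
  \<comment> \<open>Order 2 is established for every size \<open>n\<close>: continuity of
    \<open>g\<close> is derived from it, and must be known before the differences of order
    \<open>2 n - 2\<close> can be exploited.\<close>
  have diff2: "diff_nonneg 2 g J"
    unfolding diff_nonneg_def
  proof (intro allI impI, elim conjE)
    fix t h :: real assume h: "0 < h" and t: "t \<in> J" "t + real 2 * h \<in> J"
    \<comment> \<open>Two distinct nodes suffice: all indices other than \<open>i0\<close> share the
      node \<open>t / 2\<close>, so the entries at \<open>i0\<close> and \<open>j0\<close> are
      \<open>g\<close> at \<open>t\<close>, \<open>t + h\<close> and
      \<open>t + 2 * h\<close>.\<close>
    define s where "s i = (if i = i0 then t / 2 + h else t / 2)" for i
    have sub: "{t..t + real 2 * h} \<subseteq> J" using atLeastAtMost_subset_convex[OF Jop(2) t] .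
    have "s i + s j \<in> J" for i j by (rule subsetD[OF sub]) (use h in \<open>auto simp: s_def\<close>)
    then have "psd_matrix (\<chi> i j. g (s i + s j) :: real^'n^'n)" by (rule psd)
    from psd_matrix_two_entries[OF this, of i0 j0] ij
    have "0 \<le> g (t + 2 * h) - 2 * g (t + h) + g t" by (simp add: s_def add.commute)
    then show "0 \<le> (fwd_diff h ^^ 2) g t" by (simp add: fwd_diff_def numeral_2_eq_2 algebra_simps)
  qed
  have gcont: "continuous_on J g"
    using mono_on_diff_nonneg_2_continuous[OF Jop(1,2) gmono diff2] .

  \<comment> \<open>As \<open>CARD('n)\<close> is at least 2, the truncated subtractions are exact;
    for \<open>CARD('n) = 2\<close> the order \<open>k\<close> is 0.\<close>
  define k where "k = 2 * CARD('n) - 4"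
  have k: "2 * CARD('n) - 2 = Suc (Suc k)" "2 * CARD('n) - 3 = Suc k" "2 * (CARD('n) - 1) = k + 2"
    using n by (simp_all add: k_def)
  have "diff_nonneg (k + 2) g J"
    unfolding k(3)[symmetric] by (rule hankel_psd_imp_diff_nonneg[OF Jop(2)]) (rule psd)
  from diff_nonneg_imp_Ck[OF Jop(1,2) gcont this]
  have Ck: "Ck_on k g J" and diffk: "diff_nonneg 2 ((deriv ^^ k) g) J" by auto
  define H where "H = (deriv ^^ k) g"
  have Hcont: "continuous_on J H" using Ck by (simp add: Ck_on_def H_def)
  have Hconv: "convex_on J H"
    using diff_nonneg_2_imp_convex_on[OF Jop(2) Hcont] diffk by (simp add: H_def)
  obtain h where h: "\<And>x y. x \<in> J \<Longrightarrow> y \<in> J \<Longrightarrow> H x + h x * (y - x) \<le> H y"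
    and right: "\<And>x y. x \<in> J \<Longrightarrow> h x < y \<Longrightarrow> \<exists>t\<in>J. x < t \<and> h t < y"
    using convex_on_right_derivative[OF Jop(1) Hconv] by blast
  have hmono: "mono_on J h" using h by (rule subgradient_mono_on)
  have anti: "antiderivative_on J H h"
    using antiderivative_on_subgradient[OF Jop(1,2) Hconv h] .
  obtain \<mu> where \<mu>: "radon_measure_on J \<mu>"
    "distr_eq J (distr_deriv (distr_of_fun J h)) (distr_of_measure \<mu>)"
    using distr_deriv_mono_radon_measure[OF Jop hmono right] by blast
  have D0: "distr_eq J ((distr_deriv ^^ k) (distr_of_fun J g)) (distr_of_fun J H)"
    unfolding H_def by (rule distr_deriv_funpow_Ck[OF Jop Ck])
  have D1: "distr_eq J ((distr_deriv ^^ Suc k) (distr_of_fun J g)) (distr_of_fun J h)"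
    using distr_eq_trans[OF distr_eq_deriv_cong[OF D0] distr_deriv_antiderivative[OF Jop anti]] by simp
  have D2: "distr_eq J ((distr_deriv ^^ Suc (Suc k)) (distr_of_fun J g)) (distr_of_measure \<mu>)"
    using distr_eq_trans[OF distr_eq_deriv_cong[OF D1] \<mu>(2)] by simp
  have cont_int: "locally_integrable_on u J" if "continuous_on J u" for u
    using that atLeastAtMost_subset_convex[OF Jop(2)]
    by (intro locally_integrable_onI[OF Jop] borel_integrable_atLeastAtMost') (blast intro: continuous_on_subset)
  have hint: "locally_integrable_on h J"
    using anti by (intro locally_integrable_onI[OF Jop]) (auto simp: antiderivative_on_def)
  \<comment> \<open>On \<open>I\<close> the function \<open>f\<close> is \<open>g\<close> composed
    with \<open>ln\<close>, the case \<open>i = 0\<close> of \<open>Ck_on_comp_ln\<close>.\<close>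
  have gln: "g (ln x) * inverse x ^ 0 = f x" if "x \<in> I" for x
    using that lnI Ipos g[of "ln x"] by (auto simp: subset_iff)
  have fk: "Ck_on k f I"
    by (rule Ck_on_cong[OF op gln Ck_on_comp_ln[OF op Ipos Jop(1) lnI Ck]])
  then have "continuous_on I ((deriv ^^ 0) f)" unfolding Ck_on_def by blast
  then have "continuous_on I f" by simp
  moreover have "locally_absolutely_continuous_on H J"
    using subgradient_imp_locally_absolutely_continuous[OF Jop(2) h] .
  ultimately show ?thesis
    unfolding k k_def[symmetric] distr_represented_by_def
    using cont_int[OF gcont] \<mu>(1) D2 mono_on_imp_locally_bounded_variation[OF hmono] hint D1
      cont_int[OF Hcont] D0 fk
    by (intro conjI) (assumption | rule exI conjI)+
qed

end
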